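(* Let $d \ge 1$ and let $\{P_\theta\}_{\theta\in\Theta}$ be a generalized linear model of conditional distributions of $Y$ given $X=x \in \mathbb{R}^d$ of the form \[ dP_\theta(y \mid x) = \exp\big(y\,\theta^T x - A(\theta^T x)\big)\, d\nu(y), \] where $\nu$ is a base measure on the response space and $A$ is the corresponding log-partition function, with $0$ in the interior of $\operatorname{dom} A$. Let $\Theta \subset \mathbb{R}^d$ contain $0$ in its interior. For each $\theta\in\Theta$, let $P_\theta$ also denote the joint distribution of $(X,Y)$ in which $X \sim \mathrm{Uniform}(\{-1,1\}^d)$ and $Y \mid X = x \sim P_\theta(\cdot\mid x)$, with conditional density $p_\theta(y\mid x)$ with respect to $\nu$. For a conditional distribution (predictive density) $p(y\mid x)$ define the log-loss risk $R_P(p) = -\mathbb{E}_P[\log p(Y\mid X)]$ and $R_P^\star = \inf_p R_P(p)$, the infimum over all conditional distributions. Then there exists a numerical constant $c>0$ such that for all sufficiently large $n$, \[ \inf_{\widehat p_n} \sup_{\theta\in\Theta} \mathbb{E}_{P_\theta}^n\big[R_{P_\theta}(\widehat p_n) - R_{P_\theta}^\star\big] \ \ge\ c\,\frac{d}{n}, \] where the infimum is over all estimators $\widehat p_n$ that map $n$ i.i.d.\ samples $(X_i,Y_i)_{i=1}^n \sim P_\theta$ to an arbitrary conditional probability distribution of $Y$ given $X$ (not necessarily in the family $\{p_\theta\}$ or its convex hull), and $\mathbb{E}_{P_\theta}^n$ denotes expectation over the sample.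
   Context: The left-hand side is the minimax excess log-loss risk in the well-specified case (no misspecification), when the learner may play any probability distribution over $Y$ given $X$.
   Formalization: The base measure ν is additionally assumed not to be concentrated at a single point; if ν is a point mass, every p_θ is identical, the excess risk can be made zero, and the stated bound fails. *)

theory Defs
  imports "HOL-Probability.Probability"
begin

definition Rd :: "nat \<Rightarrow> (nat \<Rightarrow> real) set" where
  "Rd d = {v. \<forall>i\<ge>d. v i = 0}"

definition dotp :: "nat \<Rightarrow> (nat \<Rightarrow> real) \<Rightarrow> (nat \<Rightarrow> real) \<Rightarrow> real" where
  "dotp d u v = (\<Sum>i<d. u i * v i)"

definition cube :: "nat \<Rightarrow> (nat \<Rightarrow> real) set" where
  "cube d = {x \<in> Rd d. \<forall>i<d. x i = -1 \<or> x i = 1}"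

definition mgf :: "real measure \<Rightarrow> real \<Rightarrow> ennreal" where
  "mgf \<nu> \<eta> = (\<integral>\<^sup>+ y. ennreal (exp (y * \<eta>)) \<partial>\<nu>)"

definition domA :: "real measure \<Rightarrow> real set" where
  "domA \<nu> = {\<eta>. mgf \<nu> \<eta> < \<infinity>}"

definition logpart :: "real measure \<Rightarrow> real \<Rightarrow> real" where
  "logpart \<nu> \<eta> = ln (enn2real (mgf \<nu> \<eta>))"

definition glm_dens :: "real measure \<Rightarrow> nat \<Rightarrow> (nat \<Rightarrow> real) \<Rightarrow> (nat \<Rightarrow> real) \<Rightarrow> real \<Rightarrow> real" where
  "glm_dens \<nu> d \<theta> x y = exp (y * dotp d \<theta> x - logpart \<nu> (dotp d \<theta> x))"

definition XY :: "real measure \<Rightarrow> ((nat \<Rightarrow> real) \<times> real) measure" where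
  "XY \<nu> = count_space UNIV \<Otimes>\<^sub>M \<nu>"

definition joint :: "real measure \<Rightarrow> nat \<Rightarrow> (nat \<Rightarrow> real) \<Rightarrow> ((nat \<Rightarrow> real) \<times> real) measure" where
  "joint \<nu> d \<theta> = density (XY \<nu>)
     (\<lambda>(x, y). ennreal (indicator (cube d) x / 2 ^ d * glm_dens \<nu> d \<theta> x y))"

definition cond_dens :: "real measure \<Rightarrow> nat \<Rightarrow> ((nat \<Rightarrow> real) \<Rightarrow> real \<Rightarrow> real) \<Rightarrow> bool" where
  "cond_dens \<nu> d p \<longleftrightarrow> (\<forall>x\<in>cube d. p x \<in> borel_measurable \<nu> \<and> (\<forall>y. 0 \<le> p x y)
      \<and> (\<integral>\<^sup>+ y. ennreal (p x y) \<partial>\<nu>) = 1)"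

text \<open>Expectation of an extended-real valued function (positive part minus negative part;
  with the Isabelle convention \<infinity> - \<infinity> = \<infinity>).\<close>
definition eexp :: "'a measure \<Rightarrow> ('a \<Rightarrow> ereal) \<Rightarrow> ereal" where
  "eexp M f = enn2ereal (\<integral>\<^sup>+ z. e2ennreal (f z) \<partial>M) - enn2ereal (\<integral>\<^sup>+ z. e2ennreal (- f z) \<partial>M)"

definition neglog :: "real \<Rightarrow> ereal" where
  "neglog t = (if t \<le> 0 then \<infinity> else ereal (- ln t))"

definition risk :: "real measure \<Rightarrow> nat \<Rightarrow> (nat \<Rightarrow> real) \<Rightarrow> ((nat \<Rightarrow> real) \<Rightarrow> real \<Rightarrow> real) \<Rightarrow> ereal" where
  "risk \<nu> d \<theta> p = eexp (joint \<nu> d \<theta>) (\<lambda>(x, y). neglog (p x y))"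

definition risk_star :: "real measure \<Rightarrow> nat \<Rightarrow> (nat \<Rightarrow> real) \<Rightarrow> ereal" where
  "risk_star \<nu> d \<theta> = (INF p \<in> {p. cond_dens \<nu> d p}. risk \<nu> d \<theta> p)"

definition sample_space :: "real measure \<Rightarrow> nat \<Rightarrow> (nat \<Rightarrow> (nat \<Rightarrow> real) \<times> real) measure" where
  "sample_space \<nu> n = PiM {..<n} (\<lambda>_. XY \<nu>)"

definition estimators :: "real measure \<Rightarrow> nat \<Rightarrow> nat
    \<Rightarrow> ((nat \<Rightarrow> (nat \<Rightarrow> real) \<times> real) \<Rightarrow> (nat \<Rightarrow> real) \<Rightarrow> real \<Rightarrow> real) set" where
  "estimators \<nu> d n = {ph. (\<forall>S \<in> space (sample_space \<nu> n). cond_dens \<nu> d (ph S))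
      \<and> (\<forall>x\<in>cube d. (\<lambda>(S, y). ph S x y) \<in> borel_measurable (sample_space \<nu> n \<Otimes>\<^sub>M \<nu>))}"

definition expected_excess :: "real measure \<Rightarrow> nat \<Rightarrow> nat \<Rightarrow> (nat \<Rightarrow> real)
    \<Rightarrow> ((nat \<Rightarrow> (nat \<Rightarrow> real) \<times> real) \<Rightarrow> (nat \<Rightarrow> real) \<Rightarrow> real \<Rightarrow> real) \<Rightarrow> ereal" where
  "expected_excess \<nu> d n \<theta> ph =
     eexp (PiM {..<n} (\<lambda>_. joint \<nu> d \<theta>)) (\<lambda>S. risk \<nu> d \<theta> (ph S) - risk_star \<nu> d \<theta>)"

end

theory Submission
  imports Defs
begin

text \<open>Kullback-Leibler divergence dominates squared Hellinger distance, so the excess risk of a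
  predictor \<open>p\<close> is at least the mean squared distance of \<open>\<surd>p\<close> and \<open>\<surd>p\<^sub>\<theta>\<close>. Projecting onto the
  orthonormal functions \<open>x\<^sub>j h(y)\<close>, where \<open>h\<close> is the normalised score at the origin, Bessel's
  inequality bounds this below by \<open>\<Sum>\<^sub>j (a\<^sub>j - m\<^sub>j(\<theta>))\<^sup>2\<close> with \<open>a\<^sub>j\<close> depending on the sample only.
  For \<open>\<theta> = t \<tau>\<close> with signs \<open>\<tau>\<close> and \<open>t\<^sup>2 = 1 / (4 V n)\<close>, where \<open>V\<close> is the variance at the origin,
  flipping the sign \<open>\<tau>\<^sub>j\<close> moves \<open>m\<^sub>j\<close> by about \<open>t \<surd>V\<close>, while the Hellinger affinity of the
  two laws of the sample stays bounded below. A two-point bound for each \<open>j\<close>,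
  averaged over \<open>\<tau>\<close> as in Assouad's lemma, gives the rate \<open>d / n\<close> with constant \<open>1 / 128\<close>.\<close>

section \<open>The sign cube\<close>

text \<open>The obstacle is that the prediction is improper: no parameter describes it, and its risk
  may be infinite. Projecting its square root replaces it by \<open>d\<close> bounded real
  statistics, to which a squared-loss argument applies one coordinate at a time. The score at the
  origin is the right direction because the derivative of the square-root density at natural
  parameter 0 is a multiple of it, so for the model itself the projection loses nothing to first
  order. Orthogonality of the coordinates of the cube lets the \<open>d\<close> separate bounds add
  up, which is the origin of the factor \<open>d\<close>. All expansions are taken at the origin and
  hold only for small \<open>t\<close>, without uniformity. This is harmless: for fixed
  \<open>d\<close> and \<open>\<nu>\<close> only finitely many signs, coordinates and cube points
  occur, so the threshold on \<open>n\<close> absorbs all of it and the constant stays universal.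
  The space \<open>XY \<nu>\<close> is not sigma-finite, its first factor being counting measure on
  an uncountable set. Changes of measure are therefore made between the probability laws
  \<open>joint \<nu> d \<theta>\<close>, never relative to a product of copies of
  \<open>XY \<nu>\<close>.\<close>

definition flip :: "nat \<Rightarrow> (nat \<Rightarrow> real) \<Rightarrow> (nat \<Rightarrow> real)" where
  "flip j x = x(j := - x j)"

lemma flip_flip [simp]: "flip j (flip j x) = x"
  by (simp add: flip_def)

lemma flip_in_cube: "x \<in> cube d \<Longrightarrow> flip j x \<in> cube d"
  by (auto simp: flip_def cube_def Rd_def)

text \<open>Vectors of the cube are 0 beyond \<open>d\<close>, members of \<open>PiE\<close> are
  undefined there. The bijection changes this default value and so transfers finiteness and
  cardinality.\<close>

lemma bij_betw_restrict_cube: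
  "bij_betw (\<lambda>x. restrict x {..<d}) (cube d) (PiE {..<d} (\<lambda>_. {-1, 1}))"
proof (rule bij_betw_byWitness[where f'="\<lambda>f i. if i < d then f i else 0"])
  show "\<forall>x\<in>cube d. (\<lambda>i. if i < d then restrict x {..<d} i else 0) = x"
    by (auto simp: cube_def Rd_def fun_eq_iff)
  show "\<forall>f\<in>PiE {..<d} (\<lambda>_. {-1, 1}). restrict (\<lambda>i. if i < d then f i else 0) {..<d} = (f :: nat \<Rightarrow> real)"
    by (auto simp: PiE_def extensional_def restrict_def fun_eq_iff)
  show "(\<lambda>x. restrict x {..<d}) ` cube d \<subseteq> PiE {..<d} (\<lambda>_. {-1, 1})"
    by (intro image_subsetI PiE_I) (auto simp: cube_def restrict_def)
  show "(\<lambda>f i. if i < d then f i else 0) ` PiE {..<d} (\<lambda>_. {-1, 1}) \<subseteq> cube d"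
  proof (intro image_subsetI)
    fix f :: "nat \<Rightarrow> real" assume "f \<in> PiE {..<d} (\<lambda>_. {-1, 1})"
    then have "f i = -1 \<or> f i = 1" if "i < d" for i
      using that by (auto dest: PiE_mem)
    then show "(\<lambda>i. if i < d then f i else 0) \<in> cube d"
      by (simp add: cube_def Rd_def)
  qed
qed

lemma finite_cube [simp]: "finite (cube d)"
  using bij_betw_finite[OF bij_betw_restrict_cube[of d]] by (auto intro: finite_PiE)

lemma card_cube: "card (cube d) = 2 ^ d"
  using bij_betw_same_card[OF bij_betw_restrict_cube[of d]] by (simp add: card_PiE numeral_2_eq_2)

lemma cube_sq: "x \<in> cube d \<Longrightarrow> i < d \<Longrightarrow> x i * x i = 1"
  by (auto simp: cube_def)

lemma cube_abs: "x \<in> cube d \<Longrightarrow> i < d \<Longrightarrow> \<bar>x i\<bar> = 1"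
  by (auto simp: cube_def)

lemma sum_cube_flip: "(\<Sum>x\<in>cube d. f (flip j x)) = (\<Sum>x\<in>cube d. f x)"
  by (rule sum.reindex_bij_witness[where i="flip j" and j="flip j"]) (auto simp: flip_in_cube)

text \<open>For \<open>i\<close> different from \<open>j\<close>, flipping coordinate
  \<open>i\<close> permutes the cube and negates the summand.\<close>

lemma sum_cube_orthogonal:
  assumes "i < d" "j < d"
  shows "(\<Sum>x\<in>cube d. x i * x j) = (if i = j then 2 ^ d else 0)"
proof (cases "i = j")
  case True
  then show ?thesis using assms by (simp add: cube_sq card_cube)
next
  case False
  have "(\<Sum>x\<in>cube d. x i * x j) = (\<Sum>x\<in>cube d. flip i x i * flip i x j)"
    by (rule sum_cube_flip[symmetric])
  also have "\<dots> = - (\<Sum>x\<in>cube d. x i * x j)"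
    using False by (simp add: flip_def sum_negf)
  finally show ?thesis using False by simp
qed

text \<open>Bessel's inequality under the uniform law: the coordinate functions are orthonormal, and
  \<open>s\<close> is the projection of \<open>c\<close> onto their span.\<close>

lemma cube_bessel:
  "(\<Sum>j<d. (\<Sum>x\<in>cube d. x j * c x / 2 ^ d)\<^sup>2) \<le> (\<Sum>x\<in>cube d. (c x)\<^sup>2 / 2 ^ d)"
proof -
  define C where "C j = (\<Sum>x\<in>cube d. x j * c x / 2 ^ d)" for j
  define s where "s x = (\<Sum>j<d. C j * x j)" for x
  have cs: "(\<Sum>x\<in>cube d. c x * s x / 2 ^ d) = (\<Sum>j<d. (C j)\<^sup>2)"
  proof -
    have "(\<Sum>x\<in>cube d. c x * s x / 2 ^ d) = (\<Sum>x\<in>cube d. \<Sum>j<d. C j * (x j * c x / 2 ^ d))"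
      by (simp add: s_def sum_distrib_left sum_divide_distrib mult_ac)
    also have "\<dots> = (\<Sum>j<d. \<Sum>x\<in>cube d. C j * (x j * c x / 2 ^ d))"
      by (rule sum.swap)
    also have "\<dots> = (\<Sum>j<d. C j * C j)"
      by (intro sum.cong refl) (simp only: C_def flip: sum_distrib_left)
    finally show ?thesis
      by (simp add: power2_eq_square)
  qed
  have ss: "(\<Sum>x\<in>cube d. (s x)\<^sup>2 / 2 ^ d) = (\<Sum>j<d. (C j)\<^sup>2)"
  proof -
    have "(\<Sum>x\<in>cube d. (s x)\<^sup>2 / 2 ^ d)
        = (\<Sum>x\<in>cube d. \<Sum>i<d. \<Sum>j<d. C i * C j / 2 ^ d * (x i * x j))"
      by (simp add: s_def power2_eq_square sum_product sum_divide_distrib mult_ac)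
    also have "\<dots> = (\<Sum>i<d. \<Sum>j<d. \<Sum>x\<in>cube d. C i * C j / 2 ^ d * (x i * x j))"
      by (subst sum.swap, rule sum.cong[OF refl], rule sum.swap)
    also have "\<dots> = (\<Sum>i<d. \<Sum>j<d. if i = j then C i * C j else 0)"
      by (intro sum.cong refl) (simp only: sum_distrib_left[symmetric], auto simp: sum_cube_orthogonal)
    finally show ?thesis
      by (simp add: power2_eq_square)
  qed
  have "0 \<le> (\<Sum>x\<in>cube d. (c x - s x)\<^sup>2 / 2 ^ d)"
    by (intro sum_nonneg) simp
  also have "\<dots> = (\<Sum>x\<in>cube d. (c x)\<^sup>2 / 2 ^ d - 2 * (c x * s x / 2 ^ d) + (s x)\<^sup>2 / 2 ^ d)"
    by (intro sum.cong refl) (simp add: power2_diff diff_divide_distrib add_divide_distrib algebra_simps)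
  also have "\<dots> = (\<Sum>x\<in>cube d. (c x)\<^sup>2 / 2 ^ d) - (\<Sum>j<d. (C j)\<^sup>2)"
    by (simp only: sum.distrib sum_subtractf cs ss sum_distrib_left[symmetric])
  finally show ?thesis by (simp add: C_def)
qed

text \<open>The averaging step of Assouad's lemma. \<open>flip j\<close> is an involution of the
  cube, so the sum over neighbouring pairs counts each vertex twice.\<close>

lemma sum_cube_pairing:
  fixes f :: "(nat \<Rightarrow> real) \<Rightarrow> real"
  assumes "\<And>x. x \<in> cube d \<Longrightarrow> \<kappa> \<le> f x + f (flip j x)"
  shows "2 ^ d * \<kappa> / 2 \<le> (\<Sum>x\<in>cube d. f x)"
proof -
  have "2 ^ d * \<kappa> = (\<Sum>x\<in>cube d. \<kappa>)"
    by (simp add: card_cube)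
  also have "\<dots> \<le> (\<Sum>x\<in>cube d. f x + f (flip j x))"
    by (intro sum_mono assms)
  also have "\<dots> = 2 * (\<Sum>x\<in>cube d. f x)"
    by (simp add: sum.distrib sum_cube_flip)
  finally show ?thesis by simp
qed

lemma abs_dotp_cube_le:
  assumes "x \<in> cube d" "z \<in> cube d"
  shows "\<bar>dotp d x z\<bar> \<le> real d"
proof -
  have "\<bar>dotp d x z\<bar> \<le> (\<Sum>i<d. \<bar>x i * z i\<bar>)"
    unfolding dotp_def by (rule sum_abs)
  also have "\<dots> = real d"
    using assms by (simp add: abs_mult cube_abs)
  finally show ?thesis .
qed

lemma dotp_scale: "dotp d (\<lambda>i. t * u i) x = t * dotp d u x"
  by (simp add: dotp_def sum_distrib_left mult.assoc)

lemma dotp_flip: "j < d \<Longrightarrow> dotp d (flip j u) x = dotp d u x - 2 * u j * x j"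
proof -
  assume "j < d"
  have "dotp d (flip j u) x = (\<Sum>i<d. u i * x i - (if i = j then 2 * u j * x j else 0))"
    unfolding dotp_def by (intro sum.cong) (auto simp: flip_def)
  then show ?thesis
    using \<open>j < d\<close> by (simp add: sum_subtractf dotp_def)
qed

section \<open>Extended expectations and product densities\<close>

lemma eexp_ereal:
  assumes "integrable M g" and "AE z in M. f z = ereal (g z)"
  shows "eexp M f = ereal (\<integral>z. g z \<partial>M)"
proof -
  have 1: "(\<integral>\<^sup>+ z. e2ennreal (f z) \<partial>M) = (\<integral>\<^sup>+ z. ennreal (g z) \<partial>M)"
    using assms(2) by (intro nn_integral_cong_AE) (auto simp: e2ennreal_ereal)
  have 2: "(\<integral>\<^sup>+ z. e2ennreal (- f z) \<partial>M) = (\<integral>\<^sup>+ z. ennreal (- g z) \<partial>M)"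
    using assms(2) by (intro nn_integral_cong_AE) (auto simp: e2ennreal_ereal)
  have fin: "(\<integral>\<^sup>+ z. ennreal (g z) \<partial>M) \<noteq> \<infinity>" "(\<integral>\<^sup>+ z. ennreal (- g z) \<partial>M) \<noteq> \<infinity>"
    using assms(1) by (auto simp: real_integrable_def)
  have *: "enn2ereal A - enn2ereal B = ereal (enn2real A - enn2real B)"
    if "A \<noteq> \<infinity>" "B \<noteq> \<infinity>" for A B
    using that by (cases A; cases B) (auto simp: enn2ereal_ennreal)
  show ?thesis
    using *[OF fin] by (simp add: eexp_def 1 2 real_lebesgue_integral_def[OF assms(1)])
qed

text \<open>Monotonicity of the nonnegative integral holds for arbitrary functions, so
  \<open>f\<close> may be infinite and need not be measurable. The integrable minorant keeps the
  negative part finite, and the convention for \<infinity> - \<infinity> is never met.\<close>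

lemma eexp_ge_integral:
  assumes "integrable M g" and "AE z in M. ereal (g z) \<le> f z"
  shows "ereal (\<integral>z. g z \<partial>M) \<le> eexp M f"
proof -
  have neg: "AE z in M. - f z \<le> - ereal (g z)"
    using assms(2) by eventually_elim (simp only: ereal_minus_le_minus)
  have "eexp M (\<lambda>z. ereal (g z)) \<le> eexp M f"
    unfolding eexp_def
  proof (intro ereal_minus_mono)
    show "enn2ereal (\<integral>\<^sup>+ z. e2ennreal (ereal (g z)) \<partial>M) \<le> enn2ereal (\<integral>\<^sup>+ z. e2ennreal (f z) \<partial>M)"
      unfolding less_eq_ennreal.rep_eq[symmetric]
      using assms(2) by (intro nn_integral_mono_AE) (elim eventually_mono, rule e2ennreal_mono)
    show "enn2ereal (\<integral>\<^sup>+ z. e2ennreal (- f z) \<partial>M) \<le> enn2ereal (\<integral>\<^sup>+ z. e2ennreal (- ereal (g z)) \<partial>M)"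
      unfolding less_eq_ennreal.rep_eq[symmetric]
      using neg by (intro nn_integral_mono_AE) (elim eventually_mono, rule e2ennreal_mono)
  qed
  then show ?thesis
    using eexp_ereal[OF assms(1), of "\<lambda>z. ereal (g z)"] by simp
qed

text \<open>A product of probability measures is determined by its values on rectangles, where the
  integral of a product of one-coordinate functions factorises.\<close>

lemma PiM_density:
  assumes "finite I" "\<And>i. i \<in> I \<Longrightarrow> prob_space (M i)"
    and L: "\<And>i. i \<in> I \<Longrightarrow> L i \<in> borel_measurable (M i)"
    and prob: "\<And>i. i \<in> I \<Longrightarrow> prob_space (density (M i) (L i))"
  shows "PiM I (\<lambda>i. density (M i) (L i)) = density (PiM I M) (\<lambda>S. \<Prod>i\<in>I. L i (S i))"
proof -
  \<comment> \<open>\<open>product_sigma_finite\<close> speaks of every index, so indices outside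
    \<open>I\<close> receive a point mass with density 1.\<close>
  define M' where "M' i = (if i \<in> I then M i else return (count_space UNIV) undefined)" for i
  define L' where "L' i = (if i \<in> I then L i else (\<lambda>_. 1))" for i
  have M'[simp]: "prob_space (M' i)" for i
    using assms(2) by (auto simp: M'_def intro!: prob_space_return)
  have L'[measurable]: "L' i \<in> borel_measurable (M' i)" for i
    using L by (auto simp: L'_def M'_def)
  have D'[simp]: "prob_space (density (M' i) (L' i))" for i
    using prob by (auto simp: L'_def M'_def density_1 intro!: prob_space_return)
  interpret P: product_sigma_finite M'
    by (rule product_sigma_finite.intro) (simp add: prob_space_imp_sigma_finite)
  interpret Q: product_sigma_finite "\<lambda>i. density (M' i) (L' i)"
    by (rule product_sigma_finite.intro) (simp add: prob_space_imp_sigma_finite)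
  have "density (PiM I M') (\<lambda>S. \<Prod>i\<in>I. L' i (S i)) = PiM I (\<lambda>i. density (M' i) (L' i))"
  proof (rule Q.PiM_eqI[OF \<open>finite I\<close>])
    show "sets (density (PiM I M') (\<lambda>S. \<Prod>i\<in>I. L' i (S i))) = sets (PiM I (\<lambda>i. density (M' i) (L' i)))"
      by (simp cong: sets_PiM_cong)
  next
    fix A assume A: "\<And>i. i \<in> I \<Longrightarrow> A i \<in> sets (density (M' i) (L' i))"
    have A'[measurable]: "i \<in> I \<Longrightarrow> A i \<in> sets (M' i)" for i using A by simp
    have "emeasure (density (PiM I M') (\<lambda>S. \<Prod>i\<in>I. L' i (S i))) (PiE I A)
        = (\<integral>\<^sup>+ S. (\<Prod>i\<in>I. L' i (S i)) * indicator (PiE I A) S \<partial>PiM I M')"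
      using A' \<open>finite I\<close> by (intro emeasure_density) (auto intro!: sets_PiM_I_finite)
    also have "\<dots> = (\<integral>\<^sup>+ S. (\<Prod>i\<in>I. L' i (S i) * indicator (A i) (S i)) \<partial>PiM I M')"
    proof (intro nn_integral_cong)
      fix S assume "S \<in> space (PiM I M')"
      then have S: "S \<in> extensional I" by (auto simp: space_PiM PiE_def)
      show "(\<Prod>i\<in>I. L' i (S i)) * indicator (PiE I A) S = (\<Prod>i\<in>I. L' i (S i) * indicator (A i) (S i))"
      proof (cases "S \<in> PiE I A")
        case True
        then show ?thesis by (auto intro!: prod.cong simp: PiE_iff)
      next
        case False
        then obtain i where "i \<in> I" "S i \<notin> A i" using S by (auto simp: PiE_iff)
        then have "(\<Prod>i\<in>I. L' i (S i) * indicator (A i) (S i)) = 0"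
          using \<open>finite I\<close> by (intro prod_zero) (auto intro!: bexI[of _ i])
        then show ?thesis using False by simp
      qed
    qed
    also have "\<dots> = (\<Prod>i\<in>I. \<integral>\<^sup>+ z. L' i z * indicator (A i) z \<partial>M' i)"
      using A' by (intro P.product_nn_integral_prod[OF \<open>finite I\<close>]) auto
    also have "\<dots> = (\<Prod>i\<in>I. emeasure (density (M' i) (L' i)) (A i))"
      using A' by (intro prod.cong refl) (simp add: emeasure_density)
    finally show "emeasure (density (PiM I M') (\<lambda>S. \<Prod>i\<in>I. L' i (S i))) (PiE I A)
        = (\<Prod>i\<in>I. emeasure (density (M' i) (L' i)) (A i))" .
  qed
  moreover have "PiM I M' = PiM I M" "PiM I (\<lambda>i. density (M' i) (L' i)) = PiM I (\<lambda>i. density (M i) (L i))"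
    by (auto intro!: PiM_cong simp: M'_def L'_def)
  moreover have "(\<lambda>S. \<Prod>i\<in>I. L' i (S i)) = (\<lambda>S. \<Prod>i\<in>I. L i (S i))"
    by (auto intro!: prod.cong simp: L'_def)
  ultimately show ?thesis by simp
qed

text \<open>Le Cam's two-point bound in Hellinger form. With \<open>\<lambda> = 1 / (\<bar>m\<^sub>1 - m\<^sub>2\<bar> \<rho>)\<close>, it is
  the integral of the pointwise AM-GM bound
  \<open>\<bar>m\<^sub>1 - m\<^sub>2\<bar> \<surd>D \<le> \<lambda> (a - m\<^sub>1)\<^sup>2 + D / (4 \<lambda>) + \<lambda> D (a - m\<^sub>2)\<^sup>2 + 1 / (4 \<lambda>)\<close>.\<close>

lemma (in prob_space) two_point_bound:
  fixes a D :: "'a \<Rightarrow> real"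
  assumes D: "\<And>z. 0 \<le> D z" "integrable M D" "(\<integral>z. D z \<partial>M) = 1"
    and a1: "integrable M (\<lambda>z. (a z - m1)\<^sup>2)"
    and a2: "integrable M (\<lambda>z. D z * (a z - m2)\<^sup>2)"
    and rt: "integrable M (\<lambda>z. sqrt (D z))"
  shows "(m1 - m2)\<^sup>2 * (\<integral>z. sqrt (D z) \<partial>M)\<^sup>2 / 2
    \<le> (\<integral>z. (a z - m1)\<^sup>2 \<partial>M) + (\<integral>z. D z * (a z - m2)\<^sup>2 \<partial>M)"
proof -
  define \<rho> where "\<rho> = (\<integral>z. sqrt (D z) \<partial>M)"
  define \<Delta> where "\<Delta> = \<bar>m1 - m2\<bar>"
  define E where "E = (\<integral>z. (a z - m1)\<^sup>2 \<partial>M) + (\<integral>z. D z * (a z - m2)\<^sup>2 \<partial>M)"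
  have "0 \<le> \<rho>" unfolding \<rho>_def by (intro Bochner_Integration.integral_nonneg) (auto simp: D)
  have "0 \<le> E" unfolding E_def by (intro add_nonneg_nonneg Bochner_Integration.integral_nonneg) (auto simp: D)
  have "0 \<le> \<Delta>" by (simp add: \<Delta>_def)
  have bound: "\<Delta> * \<rho> \<le> l * E + 1 / (2 * l)" if "0 < l" for l
  proof -
    have "\<Delta> * sqrt (D z) \<le> l * (a z - m1)\<^sup>2 + D z / (4 * l) + (l * (D z * (a z - m2)\<^sup>2) + 1 / (4 * l))"
      for z
    proof -
      define q where "q = sqrt (D z)"
      have q: "0 \<le> q" "D z = q\<^sup>2" using D by (auto simp: q_def)
      have amgm: "\<bar>v\<bar> * w \<le> l * v\<^sup>2 + w\<^sup>2 / (4 * l)" for v w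
      proof -
        have "0 \<le> (2 * l * \<bar>v\<bar> - w)\<^sup>2 / (4 * l)" using \<open>0 < l\<close> by simp
        also have "\<dots> = l * v\<^sup>2 + w\<^sup>2 / (4 * l) - \<bar>v\<bar> * w"
          using \<open>0 < l\<close> by (simp add: field_simps power2_eq_square)
        finally show ?thesis by simp
      qed
      have "\<Delta> * q \<le> (\<bar>a z - m1\<bar> + \<bar>a z - m2\<bar>) * q"
        using q by (intro mult_right_mono) (auto simp: \<Delta>_def)
      also have "\<dots> = \<bar>a z - m1\<bar> * q + \<bar>q * (a z - m2)\<bar> * 1"
        using q by (simp add: abs_mult distrib_left distrib_right mult.commute[of _ q])
      also have "\<dots> \<le> (l * (a z - m1)\<^sup>2 + q\<^sup>2 / (4 * l)) + (l * (q * (a z - m2))\<^sup>2 + 1\<^sup>2 / (4 * l))"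
        by (intro add_mono amgm)
      finally show ?thesis by (simp add: power_mult_distrib flip: q(2) q_def)
    qed
    then have "(\<integral>z. \<Delta> * sqrt (D z) \<partial>M) \<le>
      (\<integral>z. l * (a z - m1)\<^sup>2 + D z / (4 * l) + (l * (D z * (a z - m2)\<^sup>2) + 1 / (4 * l)) \<partial>M)"
      using D a1 a2 rt by (intro integral_mono) auto
    also have "\<dots> = l * (\<integral>z. (a z - m1)\<^sup>2 \<partial>M) + 1 / (4 * l)
        + (l * (\<integral>z. D z * (a z - m2)\<^sup>2 \<partial>M) + 1 / (4 * l))"
      using D a1 a2 by (simp add: prob_space)
    also have "\<dots> = l * E + 1 / (2 * l)"
      using \<open>0 < l\<close> by (simp add: E_def field_simps)
    finally show ?thesis using rt by (simp add: \<rho>_def)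
  qed
  have "(\<Delta> * \<rho>)\<^sup>2 / 2 \<le> E"
  proof (cases "\<Delta> * \<rho> = 0")
    case False
    then have pos: "0 < \<Delta> * \<rho>" using \<open>0 \<le> \<rho>\<close> \<open>0 \<le> \<Delta>\<close> by (simp add: less_le)
    have "\<Delta> * \<rho> \<le> E / (\<Delta> * \<rho>) + \<Delta> * \<rho> / 2"
      using bound[of "1 / (\<Delta> * \<rho>)"] pos by simp
    then have "\<Delta> * \<rho> / 2 \<le> E / (\<Delta> * \<rho>)" by linarith
    then have "\<Delta> * \<rho> / 2 * (\<Delta> * \<rho>) \<le> E" using pos by (simp add: pos_le_divide_eq)
    then show ?thesis by (simp add: power2_eq_square)
  qed (use \<open>0 \<le> E\<close> in auto)
  then show ?thesis
    by (simp add: E_def \<rho>_def \<Delta>_def power_mult_distrib)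
qed

section \<open>Local analysis of the exponential family at the origin\<close>

text \<open>Everything follows from \<open>1 + z \<le> exp z\<close>: it places the remainder
  between 0 and \<open>z * (exp z - 1)\<close>, and bounds \<open>\<bar>exp z - 1\<bar>\<close> by
  \<open>\<bar>z\<bar> * exp \<bar>z\<bar>\<close>. The absolute value in the exponent gives one
  bound for both signs of the increment.\<close>

lemma exp_remainder_bound: "\<bar>exp z - 1 - z\<bar> \<le> z\<^sup>2 * exp \<bar>z\<bar>" for z :: real
proof -
  have lower: "0 \<le> exp z - 1 - z"
    using exp_ge_add_one_self[of z] by linarith
  have decr: "exp z - 1 \<le> z * exp z" for z :: real
  proof -
    have "(1 - z) * exp z \<le> exp (- z) * exp z"
      using exp_ge_add_one_self[of "- z"] by (intro mult_right_mono) (linarith, simp)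
    then show ?thesis by (simp add: exp_minus field_simps)
  qed
  have "\<bar>exp z - 1\<bar> \<le> \<bar>z\<bar> * exp \<bar>z\<bar>"
  proof (cases "0 \<le> z")
    case True
    then show ?thesis using decr[of z] by simp
  next
    case False
    have "1 - exp z \<le> - z" using exp_ge_add_one_self[of z] by linarith
    also have "\<dots> \<le> \<bar>z\<bar> * exp \<bar>z\<bar>"
      using False by (simp add: mult_le_cancel_left1)
    finally show ?thesis using False by simp
  qed
  then have "\<bar>z\<bar> * \<bar>exp z - 1\<bar> \<le> \<bar>z\<bar> * (\<bar>z\<bar> * exp \<bar>z\<bar>)"
    by (intro mult_left_mono) auto
  moreover have "exp z - 1 - z \<le> \<bar>z\<bar> * \<bar>exp z - 1\<bar>"
  proof -
    have "exp z - 1 - z \<le> z * (exp z - 1)" using decr[of z] by (simp add: algebra_simps)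
    also have "\<dots> \<le> \<bar>z * (exp z - 1)\<bar>" by simp
    finally show ?thesis by (simp add: abs_mult)
  qed
  ultimately show ?thesis
    using lower by (simp add: power2_eq_square mult.assoc)
qed

lemma DERIV_scale_at_0:
  fixes f :: "real \<Rightarrow> real"
  assumes "(f has_real_derivative D) (at 0)"
  shows "((\<lambda>t. f (t * s)) has_real_derivative D * s) (at 0)"
proof -
  have "((\<lambda>t. t * s) has_real_derivative s) (at 0)"
    by (auto intro!: derivative_eq_intros)
  then show ?thesis
    using DERIV_chain2[of f D "\<lambda>t. t * s" 0 s UNIV] assms by simp
qed

text \<open>The interval provides exponential moments on both sides of 0, hence moments of all
  orders. Nondegeneracy excludes point masses, for which the variance at the origin vanishes, and
  also the null measure, for which every almost-everywhere statement is true.\<close>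

locale exp_family =
  fixes \<nu> :: "real measure" and \<epsilon> :: real
  assumes sets_nu [measurable_cong, simp]: "sets \<nu> = sets borel"
    and eps_pos: "0 < \<epsilon>"
    and eps_dom: "{-\<epsilon><..<\<epsilon>} \<subseteq> domA \<nu>"
    and nondegenerate: "\<not> (\<exists>y0. AE y in \<nu>. y = y0)"
begin

section \<open>Moments of the exponentially tilted base measure\<close>

lemma space_nu [simp]: "space \<nu> = UNIV"
  using sets_eq_imp_space_eq[OF sets_nu] by simp

sublocale finite_measure \<nu>
proof
  have "0 \<in> domA \<nu>" using eps_pos eps_dom by auto
  then show "emeasure \<nu> (space \<nu>) \<noteq> \<infinity>"
    by (simp add: domA_def mgf_def)
qed

text \<open>Unnormalised moments: each is the derivative in \<open>u\<close> of the preceding one,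
  so the derivatives of the log-partition function are rational expressions in them.\<close>

definition mom :: "nat \<Rightarrow> real \<Rightarrow> real" where
  "mom k u = (\<integral>y. y ^ k * exp (y * u) \<partial>\<nu>)"

lemma integrable_exp: "u \<in> domA \<nu> \<Longrightarrow> integrable \<nu> (\<lambda>y. exp (y * u))"
  by (rule integrableI_nonneg) (auto simp: domA_def mgf_def)

lemma mom_0: "mom 0 u = enn2real (mgf \<nu> u)"
  by (simp add: mom_def mgf_def integral_eq_nn_integral)

lemma logpart_eq: "logpart \<nu> u = ln (mom 0 u)"
  by (simp add: logpart_def mom_0)

lemma mom_0_pos:
  assumes "u \<in> domA \<nu>"
  shows "0 < mom 0 u"
proof -
  have "0 \<le> mom 0 u" by (simp add: mom_0)
  moreover have "mom 0 u \<noteq> 0"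
  proof
    assume "mom 0 u = 0"
    then have "AE y in \<nu>. exp (y * u) = 0"
      using integral_nonneg_eq_0_iff_AE[OF integrable_exp[OF assms]] by (simp add: mom_def)
    \<comment> \<open>The exponential never vanishes, so the assumption is that almost every
      \<open>y\<close> satisfies a falsehood. Any conclusion follows, in particular one that
      contradicts nondegeneracy.\<close>
    then have "AE y in \<nu>. y = 0" by (rule eventually_mono) simp
    then show False using nondegenerate by blast
  qed
  ultimately show ?thesis by simp
qed

lemma eps_domI: "\<bar>u\<bar> < \<epsilon> \<Longrightarrow> u \<in> domA \<nu>"
  using eps_dom by (auto simp: abs_less_iff intro!: subsetD[OF eps_dom])

text \<open>Each factor \<open>\<bar>y\<bar>\<close> is absorbed by a slightly larger exponent,
  using half of the room between \<open>a\<close> and \<open>\<epsilon>\<close>. For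
  \<open>k = 0\<close> the two one-sided exponentials together dominate
  \<open>exp (\<bar>y\<bar> * a)\<close>.\<close>

lemma integrable_abs_power_exp:
  "0 \<le> a \<Longrightarrow> a < \<epsilon> \<Longrightarrow> integrable \<nu> (\<lambda>y. \<bar>y\<bar> ^ k * exp (\<bar>y\<bar> * a))"
proof (induction k arbitrary: a)
  case 0
  have "integrable \<nu> (\<lambda>y. exp (y * a) + exp (y * (- a)))"
    using 0 by (intro Bochner_Integration.integrable_add integrable_exp eps_domI) auto
  then show ?case
  proof (rule Bochner_Integration.integrable_bound)
    have "\<bar>exp (\<bar>y\<bar> * a)\<bar> \<le> \<bar>exp (y * a) + exp (y * (- a))\<bar>" for y
      by (cases "0 \<le> y") (auto simp: add_pos_pos[THEN less_imp_le])
    then show "AE y in \<nu>. norm (\<bar>y\<bar> ^ 0 * exp (\<bar>y\<bar> * a)) \<le> norm (exp (y * a) + exp (y * (- a)))"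
      by simp
  qed simp
next
  case (Suc k)
  define \<delta> where "\<delta> = (\<epsilon> - a) / 2"
  have \<delta>: "0 < \<delta>" "a + \<delta> < \<epsilon>" using Suc.prems by (auto simp: \<delta>_def field_simps)
  have "integrable \<nu> (\<lambda>y. (1 / \<delta>) * (\<bar>y\<bar> ^ k * exp (\<bar>y\<bar> * (a + \<delta>))))"
    using Suc \<delta> by (intro integrable_mult_right Suc.IH) auto
  then show ?case
  proof (rule Bochner_Integration.integrable_bound)
    have "\<bar>y\<bar> ^ Suc k * exp (\<bar>y\<bar> * a) \<le> (1 / \<delta>) * (\<bar>y\<bar> ^ k * exp (\<bar>y\<bar> * (a + \<delta>)))" for y :: real
    proof -
      have "\<bar>y\<bar> * \<delta> \<le> exp (\<bar>y\<bar> * \<delta>)"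
        using exp_ge_add_one_self[of "\<bar>y\<bar> * \<delta>"] by linarith
      then have "\<bar>y\<bar> \<le> (1 / \<delta>) * exp (\<bar>y\<bar> * \<delta>)"
        using \<delta> by (simp add: field_simps)
      then have "\<bar>y\<bar> * (\<bar>y\<bar> ^ k * exp (\<bar>y\<bar> * a)) \<le> (1 / \<delta>) * exp (\<bar>y\<bar> * \<delta>) * (\<bar>y\<bar> ^ k * exp (\<bar>y\<bar> * a))"
        by (intro mult_right_mono) auto
      then show ?thesis by (simp add: distrib_left exp_add mult_ac)
    qed
    then show "AE y in \<nu>. norm (\<bar>y\<bar> ^ Suc k * exp (\<bar>y\<bar> * a))
        \<le> norm ((1 / \<delta>) * (\<bar>y\<bar> ^ k * exp (\<bar>y\<bar> * (a + \<delta>))))"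
      using \<delta> by (auto simp: abs_mult)
  qed simp
qed

lemma integrable_power_exp:
  assumes "\<bar>u\<bar> < \<epsilon>"
  shows "integrable \<nu> (\<lambda>y. y ^ k * exp (y * u))"
proof (rule Bochner_Integration.integrable_bound[OF integrable_abs_power_exp[of "\<bar>u\<bar>" k]])
  have "y * u \<le> \<bar>y\<bar> * \<bar>u\<bar>" for y
    by (metis abs_ge_self abs_mult)
  then show "AE y in \<nu>. norm (y ^ k * exp (y * u)) \<le> norm (\<bar>y\<bar> ^ k * exp (\<bar>y\<bar> * \<bar>u\<bar>))"
    by (auto simp: abs_mult power_abs intro!: mult_left_mono)
qed (use assms in auto)

text \<open>Differentiation under the integral sign by a quantitative bound: the second-order
  remainder has one integrable majorant for all small \<open>h\<close>, so the difference quotient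
  errs by at most \<open>C * \<bar>h\<bar>\<close>.\<close>

lemma DERIV_mom:
  assumes u: "\<bar>u\<bar> < \<epsilon>"
  shows "(mom k has_real_derivative mom (Suc k) u) (at u)"
proof -
  \<comment> \<open>The midpoint leaves room on both sides:
    \<open>\<bar>u\<bar> + \<bar>h\<bar>\<close> stays below \<open>a\<close> for small
    \<open>h\<close>, and \<open>a < \<epsilon>\<close> keeps the majorant integrable.\<close>
  define a where "a = (\<bar>u\<bar> + \<epsilon>) / 2"
  have a: "0 \<le> a" "\<bar>u\<bar> < a" "a < \<epsilon>" using u eps_pos by (auto simp: a_def field_simps)
  define C where "C = (\<integral>y. \<bar>y\<bar> ^ (k + 2) * exp (\<bar>y\<bar> * a) \<partial>\<nu>)"
  have step: "norm ((mom k (u + h) - mom k u) / h - mom (Suc k) u) \<le> C * \<bar>h\<bar>"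
    if h: "h \<noteq> 0" "\<bar>h\<bar> < a - \<bar>u\<bar>" for h
  proof -
    have uh: "\<bar>u + h\<bar> < \<epsilon>" using h a by linarith
    have "\<bar>mom k (u + h) - mom k u - h * mom (Suc k) u\<bar>
        = \<bar>(\<integral>y. y ^ k * exp (y * (u + h)) - y ^ k * exp (y * u) - h * (y ^ Suc k * exp (y * u)) \<partial>\<nu>)\<bar>"
      unfolding mom_def
      by (subst Bochner_Integration.integral_diff Bochner_Integration.integral_mult_right
          | intro integrable_power_exp u uh Bochner_Integration.integrable_diff integrable_mult_right refl)+
    also have "\<dots> \<le> (\<integral>y. h\<^sup>2 * (\<bar>y\<bar> ^ (k + 2) * exp (\<bar>y\<bar> * a)) \<partial>\<nu>)"
    proof (rule integral_abs_bound_integral)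
      fix y :: real
      have "y ^ k * exp (y * (u + h)) - y ^ k * exp (y * u) - h * (y ^ Suc k * exp (y * u))
          = y ^ k * exp (y * u) * (exp (y * h) - 1 - y * h)"
        by (simp add: distrib_left exp_add algebra_simps)
      also have "\<bar>\<dots>\<bar> \<le> \<bar>y\<bar> ^ k * exp (y * u) * ((y * h)\<^sup>2 * exp \<bar>y * h\<bar>)"
        unfolding abs_mult power_abs abs_exp_cancel
        using exp_remainder_bound[of "y * h"] by (intro mult_left_mono) (auto simp: abs_mult)
      also have "\<dots> = h\<^sup>2 * (\<bar>y\<bar> ^ (k + 2) * exp (y * u + \<bar>y * h\<bar>))"
        by (simp add: exp_add power_mult_distrib power_add power2_eq_square mult_ac abs_mult_self_eq)
      also have "\<dots> \<le> h\<^sup>2 * (\<bar>y\<bar> ^ (k + 2) * exp (\<bar>y\<bar> * a))"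
      proof -
        have "y * u + \<bar>y * h\<bar> \<le> \<bar>y\<bar> * (\<bar>u\<bar> + \<bar>h\<bar>)"
          using abs_ge_self[of "y * u"] by (simp add: abs_mult distrib_left)
        also have "\<dots> \<le> \<bar>y\<bar> * a" using h by (intro mult_left_mono) auto
        finally show ?thesis by (intro mult_left_mono) auto
      qed
      finally show "\<bar>y ^ k * exp (y * (u + h)) - y ^ k * exp (y * u) - h * (y ^ Suc k * exp (y * u))\<bar>
          \<le> h\<^sup>2 * (\<bar>y\<bar> ^ (k + 2) * exp (\<bar>y\<bar> * a))" .
    qed (use u uh a in \<open>intro integrable_power_exp Bochner_Integration.integrable_diff
          integrable_mult_right integrable_abs_power_exp; simp\<close>)+
    also have "\<dots> = h\<^sup>2 * C"
      unfolding C_def by (rule integral_mult_right_zero)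
    also have "\<dots> = C * \<bar>h\<bar> * \<bar>h\<bar>"
      by (simp add: power2_eq_square mult.assoc)
    finally have "\<bar>mom k (u + h) - mom k u - h * mom (Suc k) u\<bar> \<le> C * \<bar>h\<bar> * \<bar>h\<bar>" .
    moreover have "(mom k (u + h) - mom k u) / h - mom (Suc k) u
        = (mom k (u + h) - mom k u - h * mom (Suc k) u) / h"
      using h by (simp add: field_simps)
    ultimately show ?thesis
      using h by (simp add: pos_divide_le_eq)
  qed
  have "((\<lambda>h. (mom k (u + h) - mom k u) / h - mom (Suc k) u) \<longlongrightarrow> 0) (at 0)"
  proof (rule Lim_null_comparison)
    show "\<forall>\<^sub>F h in at 0. norm ((mom k (u + h) - mom k u) / h - mom (Suc k) u) \<le> C * \<bar>h\<bar>"
      unfolding eventually_at using a step by (intro exI[of _ "a - \<bar>u\<bar>"]) (auto simp: dist_real_def)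
    show "((\<lambda>h. C * \<bar>h\<bar>) \<longlongrightarrow> 0) (at 0)"
      by (intro tendsto_eq_intros) auto
  qed
  then show ?thesis
    unfolding DERIV_def by (simp add: LIM_zero_iff)
qed

definition \<mu> :: real where "\<mu> = mom 1 0 / mom 0 0"

text \<open>The base measure is not normalised. Dividing by its total mass gives the variance under
  the member with natural parameter 0.\<close>

definition V :: real where "V = (\<integral>y. (y - \<mu>)\<^sup>2 \<partial>\<nu>) / mom 0 0"

lemma Z0_pos: "0 < mom 0 0"
  using eps_pos by (intro mom_0_pos eps_domI) auto

lemma integrable_power: "integrable \<nu> (\<lambda>y. y ^ k)"
  using integrable_power_exp[of 0 k] eps_pos by simp

lemma integrable_id [simp]: "integrable \<nu> (\<lambda>y. y)"
  using integrable_power[of 1] by simp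

lemma integrable_centered_sq [simp]: "integrable \<nu> (\<lambda>y. (y - \<mu>)\<^sup>2)"
  unfolding power2_diff using integrable_power[of 2]
  by (intro Bochner_Integration.integrable_add Bochner_Integration.integrable_diff) auto

lemma V_eq: "V = mom 2 0 / mom 0 0 - \<mu>\<^sup>2"
proof -
  have "(\<integral>y. (y - \<mu>)\<^sup>2 \<partial>\<nu>) = (\<integral>y. y\<^sup>2 - 2 * \<mu> * y + \<mu>\<^sup>2 \<partial>\<nu>)"
    by (simp add: power2_diff algebra_simps)
  also have "\<dots> = mom 2 0 - 2 * \<mu> * mom 1 0 + \<mu>\<^sup>2 * mom 0 0"
    using integrable_power[of 2] by (simp add: mom_def)
  finally show ?thesis
    using Z0_pos by (simp add: V_def \<mu>_def field_simps power2_eq_square)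
qed

lemma V_pos: "0 < V"
proof -
  have "(\<integral>y. (y - \<mu>)\<^sup>2 \<partial>\<nu>) \<noteq> 0"
  proof
    assume "(\<integral>y. (y - \<mu>)\<^sup>2 \<partial>\<nu>) = 0"
    then have "AE y in \<nu>. (y - \<mu>)\<^sup>2 = 0"
      by (subst (asm) integral_nonneg_eq_0_iff_AE) auto
    then have "AE y in \<nu>. y = \<mu>" by simp
    then show False using nondegenerate by blast
  qed
  moreover have "0 \<le> (\<integral>y. (y - \<mu>)\<^sup>2 \<partial>\<nu>)" by simp
  ultimately show ?thesis
    using Z0_pos unfolding V_def by (intro divide_pos_pos) linarith+
qed

section \<open>Second-order behaviour of the log-partition function at the origin\<close>

abbreviation A :: "real \<Rightarrow> real" where "A \<equiv> logpart \<nu>"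

lemma DERIV_A: "\<bar>u\<bar> < \<epsilon> \<Longrightarrow> (A has_real_derivative mom 1 u / mom 0 u) (at u)"
  using DERIV_mom[of u 0] mom_0_pos[OF eps_domI, of u]
  by (auto simp: logpart_eq[abs_def] intro!: derivative_eq_intros)

lemma DERIV_A': "((\<lambda>u. mom 1 u / mom 0 u) has_real_derivative V) (at 0)"
  using DERIV_mom[of 0 0] DERIV_mom[of 0 1] eps_pos Z0_pos
  by (auto intro!: derivative_eq_intros
      simp: V_eq \<mu>_def power2_eq_square numeral_2_eq_2 field_simps)

text \<open>The left-hand side is the logarithm of the Hellinger affinity of the members with natural
  parameters \<open>t s\<^sub>1\<close> and \<open>t s\<^sub>2\<close>.\<close>

lemma log_affinity_ge:
  assumes s: "(s1 - s2)\<^sup>2 = 4"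
  shows "\<forall>\<^sub>F t in at_right 0. - V * t\<^sup>2 \<le> A (t * ((s1 + s2) / 2)) - A (t * s1) / 2 - A (t * s2) / 2"
proof -
  define s3 where "s3 = (s1 + s2) / 2"
  define F where "F t = A (t * s3) - A (t * s1) / 2 - A (t * s2) / 2" for t
  define a where "a u = mom 1 u / mom 0 u" for u
  define G where "G t = s3 * a (t * s3) - s1 * a (t * s1) / 2 - s2 * a (t * s2) / 2" for t
  have F': "(F has_real_derivative G t) (at t)"
    if "\<bar>t * s1\<bar> < \<epsilon>" "\<bar>t * s2\<bar> < \<epsilon>" "\<bar>t * s3\<bar> < \<epsilon>" for t
    unfolding F_def[abs_def] G_def a_def
    by (auto intro!: derivative_eq_intros DERIV_chain2[OF DERIV_A] that simp: field_simps)
  have G': "(G has_real_derivative - V) (at 0)"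
  proof -
    have d: "((\<lambda>t. a (t * s)) has_real_derivative V * s) (at 0)" for s
      using DERIV_scale_at_0[OF DERIV_A', of s] by (simp add: a_def)
    have "- V = s3 * (V * s3) - s1 * (V * s1) / 2 - s2 * (V * s2) / 2"
    proof -
      have "s3 * (V * s3) - s1 * (V * s1) / 2 - s2 * (V * s2) / 2 = - V * (s1 - s2)\<^sup>2 / 4"
        by (simp add: s3_def field_simps power2_eq_square)
      then show ?thesis using s by simp
    qed
    then show ?thesis
      unfolding G_def[abs_def] by (auto intro!: derivative_eq_intros d simp: mult_ac)
  qed
  have G0: "G 0 = 0" by (simp add: G_def s3_def field_simps)
  have F0: "F 0 = 0" by (simp add: F_def)
  have "((\<lambda>t. G t / t) \<longlongrightarrow> - V) (at 0)"
    using G' G0 by (simp add: DERIV_def)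
  then have "((\<lambda>t. G t / t) \<longlongrightarrow> - V) (at_right 0)"
    by (rule filterlim_mono) (auto simp: at_within_le_at)
  \<comment> \<open>Since \<open>G\<close> is the derivative of \<open>F\<close>, the true order of
    \<open>F t\<close> is \<open>- V * t\<^sup>2 / 2\<close>. Giving away a factor 2 makes the
    estimate strict, and integrating it through monotonicity of \<open>F t + V * t\<^sup>2\<close>
    uses the second derivative of \<open>A\<close> at the origin only.\<close>
  then have "\<forall>\<^sub>F t in at_right 0. - (2 * V) < G t / t"
    using V_pos by (intro order_tendstoD) auto
  moreover have "\<forall>\<^sub>F t in at_right 0. \<bar>t * s\<bar> < \<epsilon>" for s
  proof -
    have "((\<lambda>t. \<bar>t * s\<bar>) \<longlongrightarrow> 0) (at_right 0)"
      by (intro tendsto_eq_intros) auto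
    then show ?thesis using eps_pos by (intro order_tendstoD) auto
  qed
  ultimately have "\<forall>\<^sub>F t in at_right 0. - (2 * V) < G t / t \<and> \<bar>t * s1\<bar> < \<epsilon> \<and> \<bar>t * s2\<bar> < \<epsilon> \<and> \<bar>t * s3\<bar> < \<epsilon>"
    by (intro eventually_conj) auto
  then obtain b where b: "0 < b"
    "\<And>t. 0 < t \<Longrightarrow> t < b \<Longrightarrow> - (2 * V) < G t / t \<and> \<bar>t * s1\<bar> < \<epsilon> \<and> \<bar>t * s2\<bar> < \<epsilon> \<and> \<bar>t * s3\<bar> < \<epsilon>"
    by (auto simp: eventually_at_right_field)
  have "- V * t\<^sup>2 \<le> F t" if t: "0 < t" "t < b" for t
  proof -
    have "F 0 + V * 0\<^sup>2 \<le> F t + V * t\<^sup>2"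
    proof (rule DERIV_nonneg_imp_nondecreasing[where f="\<lambda>t. F t + V * t\<^sup>2"])
      fix z assume z: "0 \<le> z" "z \<le> t"
      have "((\<lambda>t. F t + V * t\<^sup>2) has_real_derivative G z + 2 * V * z) (at z)"
        using b(2)[of z] z t eps_pos
        by (cases "z = 0") (auto intro!: derivative_eq_intros F')
      moreover have "0 \<le> G z + 2 * V * z"
        using b(2)[of z] z t G0 by (cases "z = 0") (auto simp: field_simps)
      ultimately show "\<exists>y. ((\<lambda>t. F t + V * t\<^sup>2) has_real_derivative y) (at z) \<and> 0 \<le> y" by blast
    qed (use t in simp)
    then show ?thesis using F0 by simp
  qed
  then show ?thesis
    unfolding eventually_at_right_field using b(1) by (auto simp: F_def s3_def)
qed

section \<open>The normalised score and the projection of the model onto it\<close>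

definition score :: "real \<Rightarrow> real" where
  "score y = (y - \<mu>) / sqrt (V * mom 0 0)"

lemma score_measurable [measurable]: "score \<in> borel_measurable \<nu>"
  unfolding score_def by measurable

lemma integrable_score_sq: "integrable \<nu> (\<lambda>y. (score y)\<^sup>2)"
  unfolding score_def power_divide by (intro integrable_divide) simp

lemma integral_score_sq: "(\<integral>y. (score y)\<^sup>2 \<partial>\<nu>) = 1"
  using V_pos Z0_pos by (simp add: score_def power_divide) (simp add: V_def)

text \<open>The inner product in L2 of the base measure between the score and the square root of the
  density with natural parameter \<open>u\<close>.\<close>

definition \<psi> :: "real \<Rightarrow> real" where
  "\<psi> u = (\<integral>y. score y * sqrt (exp (y * u - A u)) \<partial>\<nu>)"

text \<open>A square root halves the natural parameter, which reduces \<psi> to moments at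
  \<open>u / 2\<close>.\<close>

lemma psi_eq:
  assumes "\<bar>u\<bar> < \<epsilon>"
  shows "\<psi> u = exp (- A u / 2) * (mom 1 (u / 2) - \<mu> * mom 0 (u / 2)) / sqrt (V * mom 0 0)"
proof -
  have sqrt_exp: "sqrt (exp z) = exp (z / 2)" for z :: real
    by (rule real_sqrt_unique) (auto simp flip: exp_double)
  have u2: "\<bar>u / 2\<bar> < \<epsilon>" using assms by simp
  have "\<psi> u = (\<integral>y. exp (- A u / 2) / sqrt (V * mom 0 0)
      * (y ^ 1 * exp (y * (u / 2)) - \<mu> * (y ^ 0 * exp (y * (u / 2)))) \<partial>\<nu>)"
    unfolding \<psi>_def
  proof (intro Bochner_Integration.integral_cong refl)
    fix y
    have "sqrt (exp (y * u - A u)) = exp (- A u / 2) * exp (y * (u / 2))"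
      unfolding sqrt_exp exp_add[symmetric] by (simp add: diff_divide_distrib)
    then show "score y * sqrt (exp (y * u - A u)) = exp (- A u / 2) / sqrt (V * mom 0 0)
        * (y ^ 1 * exp (y * (u / 2)) - \<mu> * (y ^ 0 * exp (y * (u / 2))))"
      by (simp add: score_def algebra_simps diff_divide_distrib)
  qed
  also have "\<dots> = exp (- A u / 2) / sqrt (V * mom 0 0) * (mom 1 (u / 2) - \<mu> * mom 0 (u / 2))"
    unfolding mom_def using integrable_power_exp[OF u2, of 0] integrable_power_exp[OF u2, of 1]
    by (simp only: integral_mult_right_zero Bochner_Integration.integral_diff integrable_mult_right)
  finally show ?thesis by simp
qed

text \<open>The density at 0 is the constant \<open>1 / mom 0 0\<close>, so the square-root density
  has derivative \<open>(y - \<mu>) / 2\<close> times \<open>1 / sqrt (mom 0 0)\<close>. This is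
  \<open>sqrt V / 2\<close> times the score, whose norm is 1.\<close>

lemma DERIV_psi: "(\<psi> has_real_derivative sqrt V / 2) (at 0)"
proof -
  define g where "g u = exp (- A u / 2) * (mom 1 (u / 2) - \<mu> * mom 0 (u / 2)) / sqrt (V * mom 0 0)" for u
  have d: "((\<lambda>u. mom k (u / 2)) has_real_derivative mom (Suc k) 0 / 2) (at 0)" for k
    using DERIV_scale_at_0[OF DERIV_mom[of 0 k], of "1 / 2"] eps_pos by simp
  have a0: "exp (- A 0 / 2) = 1 / sqrt (mom 0 0)"
  proof -
    have "exp (A 0 / 2) = sqrt (mom 0 0)"
      using Z0_pos by (intro real_sqrt_unique[symmetric]) (auto simp: logpart_eq simp flip: exp_double)
    then show ?thesis by (simp add: exp_minus field_simps)
  qed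
  have "(g has_real_derivative exp (- A 0 / 2) * (mom 2 0 / 2 - \<mu> * (mom 1 0 / 2)) / sqrt (V * mom 0 0)) (at 0)"
    unfolding g_def[abs_def] using d[of 0] d[of 1] DERIV_A[of 0] eps_pos Z0_pos
    by (intro DERIV_cdivide) (auto intro!: derivative_eq_intros simp: \<mu>_def numeral_2_eq_2)
  also have "exp (- A 0 / 2) * (mom 2 0 / 2 - \<mu> * (mom 1 0 / 2)) / sqrt (V * mom 0 0) = sqrt V / 2"
  proof -
    have "mom 2 0 / 2 - \<mu> * (mom 1 0 / 2) = V * mom 0 0 / 2"
      using Z0_pos by (simp add: V_eq \<mu>_def field_simps power2_eq_square)
    moreover have "V * mom 0 0 / (sqrt (mom 0 0) * sqrt (V * mom 0 0)) = sqrt V"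
      using V_pos Z0_pos by (simp add: real_sqrt_mult field_simps)
    moreover have "exp (- A 0 / 2) * (V * mom 0 0 / 2) / sqrt (V * mom 0 0)
        = V * mom 0 0 / (sqrt (mom 0 0) * sqrt (V * mom 0 0)) / 2"
      unfolding a0 by simp
    ultimately show ?thesis by (simp only:)
  qed
  finally have "(g has_real_derivative sqrt V / 2) (at 0)" .
  moreover have "\<forall>\<^sub>F u in nhds 0. \<psi> u = g u"
    unfolding eventually_nhds_metric using eps_pos
    by (intro exI[of _ \<epsilon>]) (auto simp: dist_real_def psi_eq g_def)
  ultimately show ?thesis
    using DERIV_cong_ev by blast
qed

text \<open>The coefficient of the square-root model density along the function sending
  \<open>(x, y)\<close> to \<open>x j * score y\<close>, in L2 of the uniform law on the cube times
  the base measure.\<close>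

definition coef :: "nat \<Rightarrow> nat \<Rightarrow> (nat \<Rightarrow> real) \<Rightarrow> real" where
  "coef d j \<theta> = (\<Sum>x\<in>cube d. x j * \<psi> (dotp d \<theta> x) / 2 ^ d)"

text \<open>To first order \<psi> is linear in \<open>dotp d \<tau> x\<close>, and orthogonality on
  the cube removes every sign except that of coordinate \<open>j\<close>.\<close>

lemma DERIV_coef:
  assumes "j < d"
  shows "((\<lambda>t. coef d j (\<lambda>i. t * \<tau> i)) has_real_derivative sqrt V / 2 * \<tau> j) (at 0)"
proof -
  have d: "((\<lambda>t. \<psi> (t * s)) has_real_derivative sqrt V / 2 * s) (at 0)" for s
    by (rule DERIV_scale_at_0[OF DERIV_psi])
  have "((\<lambda>t. coef d j (\<lambda>i. t * \<tau> i)) has_real_derivative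
      (\<Sum>x\<in>cube d. x j * (sqrt V / 2 * dotp d \<tau> x) / 2 ^ d)) (at 0)"
    unfolding coef_def dotp_scale
    by (intro DERIV_sum DERIV_cdivide DERIV_cmult d)
  also have "(\<Sum>x\<in>cube d. x j * (sqrt V / 2 * dotp d \<tau> x) / 2 ^ d)
      = (\<Sum>x\<in>cube d. \<Sum>i<d. sqrt V / 2 * \<tau> i / 2 ^ d * (x i * x j))"
    by (intro sum.cong refl) (simp add: dotp_def sum_distrib_left sum_distrib_right sum_divide_distrib mult_ac)
  also have "\<dots> = (\<Sum>i<d. sqrt V / 2 * \<tau> i / 2 ^ d * (\<Sum>x\<in>cube d. x i * x j))"
    by (subst sum.swap) (simp only: sum_distrib_left)
  also have "\<dots> = (\<Sum>i<d. if i = j then sqrt V / 2 * \<tau> j else 0)"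
    using assms by (intro sum.cong refl) (auto simp: sum_cube_orthogonal)
  also have "\<dots> = sqrt V / 2 * \<tau> j" using assms by simp
  finally show ?thesis .
qed

text \<open>The two derivatives have opposite signs, so the difference is asymptotic to
  \<open>sqrt V * \<tau> j * t\<close> and its square to \<open>V * t\<^sup>2\<close>. The factor
  1/4 is slack that absorbs the higher-order terms.\<close>

lemma coef_separation:
  assumes "j < d" "\<tau> \<in> cube d"
  shows "\<forall>\<^sub>F t in at_right 0.
    V * t\<^sup>2 / 4 \<le> (coef d j (\<lambda>i. t * \<tau> i) - coef d j (\<lambda>i. t * flip j \<tau> i))\<^sup>2"
proof -
  define f where "f t = coef d j (\<lambda>i. t * \<tau> i) - coef d j (\<lambda>i. t * flip j \<tau> i)" for t
  have "(f has_real_derivative sqrt V / 2 * \<tau> j - sqrt V / 2 * flip j \<tau> j) (at 0)"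
    unfolding f_def[abs_def] by (intro DERIV_diff DERIV_coef assms)
  then have "((\<lambda>t. f t / t) \<longlongrightarrow> sqrt V * \<tau> j) (at 0)"
    by (simp add: DERIV_def f_def flip_def mult.commute)
  then have "((\<lambda>t. (f t / t)\<^sup>2) \<longlongrightarrow> (sqrt V * \<tau> j)\<^sup>2) (at 0)"
    by (intro tendsto_power)
  moreover have "(sqrt V * \<tau> j)\<^sup>2 = V"
    using V_pos cube_sq[OF assms(2,1)] by (simp add: power_mult_distrib power2_eq_square[of "\<tau> j"])
  ultimately have "((\<lambda>t. (f t / t)\<^sup>2) \<longlongrightarrow> V) (at 0)"
    by simp
  then have "((\<lambda>t. (f t / t)\<^sup>2) \<longlongrightarrow> V) (at_right 0)"
    by (rule filterlim_mono) (auto simp: at_within_le_at)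
  then have "\<forall>\<^sub>F t in at_right 0. V / 4 < (f t / t)\<^sup>2"
    using V_pos by (intro order_tendstoD) auto
  moreover have "\<forall>\<^sub>F t in at_right 0. (0 :: real) < t"
    by (simp add: eventually_at_right_less)
  ultimately show ?thesis
  proof eventually_elim
    case (elim t)
    then have "V / 4 * t\<^sup>2 \<le> (f t)\<^sup>2"
      by (simp add: power_divide pos_less_divide_eq)
    then show ?case by (simp add: f_def)
  qed
qed

end

section \<open>The joint distribution\<close>

context exp_family
begin

lemma integrable_dens:
  assumes "\<bar>u\<bar> < \<epsilon>"
  shows "integrable \<nu> (\<lambda>y. exp (y * u - A u))"
  unfolding exp_diff using integrable_exp[OF eps_domI[OF assms]] by (intro integrable_divide)

lemma integral_dens:
  assumes "\<bar>u\<bar> < \<epsilon>"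
  shows "(\<integral>y. exp (y * u - A u) \<partial>\<nu>) = 1"
  unfolding exp_diff using mom_0_pos[OF eps_domI[OF assms]] by (simp add: logpart_eq mom_def)

lemma glm_pos: "0 < glm_dens \<nu> d \<theta> x y"
  by (simp add: glm_dens_def)

lemma glm_measurable [measurable]: "glm_dens \<nu> d \<theta> x \<in> borel_measurable \<nu>"
  unfolding glm_dens_def by measurable

text \<open>All natural parameters that occur under the design stay in the interval where every
  moment exists.\<close>

definition admissible :: "nat \<Rightarrow> (nat \<Rightarrow> real) \<Rightarrow> bool" where
  "admissible d \<theta> \<longleftrightarrow> (\<forall>x\<in>cube d. \<bar>dotp d \<theta> x\<bar> < \<epsilon>)"

lemma integrable_glm:
  "admissible d \<theta> \<Longrightarrow> x \<in> cube d \<Longrightarrow> integrable \<nu> (glm_dens \<nu> d \<theta> x)"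
  unfolding glm_dens_def[abs_def] admissible_def by (intro integrable_dens) auto

lemma integral_glm:
  "admissible d \<theta> \<Longrightarrow> x \<in> cube d \<Longrightarrow> (\<integral>y. glm_dens \<nu> d \<theta> x y \<partial>\<nu>) = 1"
  unfolding glm_dens_def[abs_def] admissible_def by (intro integral_dens) auto

lemma cond_dens_glm:
  assumes "admissible d \<theta>"
  shows "cond_dens \<nu> d (glm_dens \<nu> d \<theta>)"
  unfolding cond_dens_def
proof (intro ballI conjI allI)
  fix x assume x: "x \<in> cube d"
  show "(\<integral>\<^sup>+ y. ennreal (glm_dens \<nu> d \<theta> x y) \<partial>\<nu>) = 1"
    using integrable_glm[OF assms x] integral_glm[OF assms x]
    by (subst nn_integral_eq_integral) (auto simp: glm_pos less_imp_le)
qed (auto simp: glm_pos less_imp_le)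

section \<open>Measurability and integration for the joint law\<close>

lemma measurable_XY_fst: "(\<lambda>z. g (fst z)) \<in> borel_measurable (XY \<nu>)"
  unfolding XY_def by (rule measurable_compose[OF measurable_fst]) simp

lemma measurable_XY_snd: "g \<in> borel_measurable \<nu> \<Longrightarrow> (\<lambda>z. g (snd z)) \<in> borel_measurable (XY \<nu>)"
  unfolding XY_def by (rule measurable_compose[OF measurable_snd])

text \<open>A predictor is known to be measurable in \<open>y\<close> for each fixed
  \<open>x\<close> of the cube only. On an uncountable set of \<open>x\<close> this would not give
  joint measurability; cut off to a finite set, the function is a finite sum of products of
  measurable functions.\<close>

lemma measurable_XY_finite_support:
  fixes f :: "(nat \<Rightarrow> real) \<Rightarrow> real \<Rightarrow> real"
  assumes "finite C" "\<And>x. x \<in> C \<Longrightarrow> f x \<in> borel_measurable \<nu>"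
  shows "(\<lambda>z. if fst z \<in> C then f (fst z) (snd z) else 0) \<in> borel_measurable (XY \<nu>)"
proof -
  have "(\<lambda>z. \<Sum>c\<in>C. indicator {c} (fst z) * f c (snd z)) \<in> borel_measurable (XY \<nu>)"
    using assms(2) by (intro borel_measurable_sum borel_measurable_times measurable_XY_fst measurable_XY_snd)
  moreover have "(\<Sum>c\<in>C. indicator {c} (fst z) * f c (snd z))
      = (if fst z \<in> C then f (fst z) (snd z) else 0)" for z
  proof -
    have "(\<Sum>c\<in>C. indicator {c} (fst z) * f c (snd z))
        = (\<Sum>c\<in>C. if c = fst z then f (fst z) (snd z) else 0)"
      by (intro sum.cong) (auto simp: indicator_def)
    then show ?thesis using assms(1) by simp
  qed
  ultimately show ?thesis by simp
qed

lemma glm_XY_measurable: "(\<lambda>z. glm_dens \<nu> d \<theta> (fst z) (snd z)) \<in> borel_measurable (XY \<nu>)"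
proof -
  have [measurable]: "(\<lambda>z. g (fst z)) \<in> borel_measurable (XY \<nu>)" for g :: "(nat \<Rightarrow> real) \<Rightarrow> real"
    by (rule measurable_XY_fst)
  have [measurable]: "snd \<in> borel_measurable (XY \<nu>)"
    using measurable_XY_snd[of "\<lambda>y. y"] by simp
  show ?thesis unfolding glm_dens_def by measurable
qed

lemma joint_weight_measurable [measurable]:
  "(\<lambda>(x, y). ennreal (indicator (cube d) x / 2 ^ d * glm_dens \<nu> d \<theta> x y)) \<in> borel_measurable (XY \<nu>)"
  unfolding case_prod_beta
  using glm_XY_measurable[of d \<theta>] measurable_XY_fst[of "\<lambda>x. indicator (cube d) x / 2 ^ d :: real"]
  by (intro measurable_compose[OF _ measurable_ennreal] borel_measurable_times)

lemma sets_joint [simp, measurable_cong]: "sets (joint \<nu> d \<theta>) = sets (XY \<nu>)"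
  by (simp add: joint_def)

lemma space_XY [simp]: "space (XY \<nu>) = UNIV"
  by (simp add: XY_def space_pair_measure)

lemma space_joint [simp]: "space (joint \<nu> d \<theta>) = UNIV"
  by (simp add: joint_def)

text \<open>The iterated integral takes sigma-finiteness from the inner measure \<open>\<nu>\<close>
  alone, so the counting measure causes no trouble, and the indicator of the cube leaves a finite
  sum.\<close>

lemma nn_integral_joint:
  assumes g[measurable]: "g \<in> borel_measurable (XY \<nu>)"
  shows "(\<integral>\<^sup>+ z. g z \<partial>joint \<nu> d \<theta>)
    = (\<Sum>x\<in>cube d. \<integral>\<^sup>+ y. ennreal (glm_dens \<nu> d \<theta> x y / 2 ^ d) * g (x, y) \<partial>\<nu>)"
proof -
  let ?w = "\<lambda>(x, y). ennreal (indicator (cube d) x / 2 ^ d * glm_dens \<nu> d \<theta> x y)"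
  have "(\<lambda>z. ?w z * g z) \<in> borel_measurable (XY \<nu>)" by measurable
  then have m: "(\<lambda>z. ?w z * g z) \<in> borel_measurable (count_space UNIV \<Otimes>\<^sub>M \<nu>)"
    by (simp add: XY_def)
  have "(\<integral>\<^sup>+ z. g z \<partial>joint \<nu> d \<theta>) = (\<integral>\<^sup>+ z. ?w z * g z \<partial>XY \<nu>)"
    unfolding joint_def by (rule nn_integral_density) measurable
  also have "\<dots> = (\<integral>\<^sup>+ x. \<integral>\<^sup>+ y. ?w (x, y) * g (x, y) \<partial>\<nu> \<partial>count_space UNIV)"
    unfolding XY_def by (rule nn_integral_fst[OF m, symmetric])
  also have "\<dots> = (\<Sum>x\<in>cube d. \<integral>\<^sup>+ y. ?w (x, y) * g (x, y) \<partial>\<nu>)"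
    by (rule nn_integral_count_space') auto
  also have "\<dots> = (\<Sum>x\<in>cube d. \<integral>\<^sup>+ y. ennreal (glm_dens \<nu> d \<theta> x y / 2 ^ d) * g (x, y) \<partial>\<nu>)"
    by (intro sum.cong refl nn_integral_cong) simp
  finally show ?thesis .
qed

lemma section_XY_measurable:
  "g \<in> borel_measurable (XY \<nu>) \<Longrightarrow> (\<lambda>y. g (x, y)) \<in> borel_measurable \<nu>"
  unfolding XY_def by (erule measurable_Pair2) simp

lemma has_bochner_integral_joint_nonneg:
  fixes g :: "(nat \<Rightarrow> real) \<times> real \<Rightarrow> real"
  assumes g: "g \<in> borel_measurable (XY \<nu>)" and nn: "\<And>z. 0 \<le> g z"
    and int: "\<And>x. x \<in> cube d \<Longrightarrow> integrable \<nu> (\<lambda>y. glm_dens \<nu> d \<theta> x y * g (x, y))"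
  shows "has_bochner_integral (joint \<nu> d \<theta>) g
    (\<Sum>x\<in>cube d. (\<integral>y. glm_dens \<nu> d \<theta> x y * g (x, y) \<partial>\<nu>) / 2 ^ d)"
proof (rule has_bochner_integral_nn_integral)
  have pos: "0 \<le> (\<integral>y. glm_dens \<nu> d \<theta> x y * g (x, y) \<partial>\<nu>) / 2 ^ d" for x
    by (intro divide_nonneg_nonneg Bochner_Integration.integral_nonneg mult_nonneg_nonneg nn)
       (auto simp: glm_pos less_imp_le)
  have "(\<integral>\<^sup>+ z. ennreal (g z) \<partial>joint \<nu> d \<theta>)
      = (\<Sum>x\<in>cube d. \<integral>\<^sup>+ y. ennreal (glm_dens \<nu> d \<theta> x y / 2 ^ d) * ennreal (g (x, y)) \<partial>\<nu>)"
    using g by (intro nn_integral_joint) measurable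
  also have "\<dots> = (\<Sum>x\<in>cube d. ennreal ((\<integral>y. glm_dens \<nu> d \<theta> x y * g (x, y) \<partial>\<nu>) / 2 ^ d))"
  proof (intro sum.cong refl)
    fix x assume x: "x \<in> cube d"
    have "(\<integral>\<^sup>+ y. ennreal (glm_dens \<nu> d \<theta> x y / 2 ^ d) * ennreal (g (x, y)) \<partial>\<nu>)
        = (\<integral>\<^sup>+ y. ennreal (glm_dens \<nu> d \<theta> x y * g (x, y) / 2 ^ d) \<partial>\<nu>)"
      using glm_pos[THEN less_imp_le] nn by (intro nn_integral_cong) (simp flip: ennreal_mult)
    also have "\<dots> = ennreal (\<integral>y. glm_dens \<nu> d \<theta> x y * g (x, y) / 2 ^ d \<partial>\<nu>)"
      using glm_pos[THEN less_imp_le] nn int[OF x]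
      by (intro nn_integral_eq_integral integrable_divide) auto
    finally show "(\<integral>\<^sup>+ y. ennreal (glm_dens \<nu> d \<theta> x y / 2 ^ d) * ennreal (g (x, y)) \<partial>\<nu>)
        = ennreal ((\<integral>y. glm_dens \<nu> d \<theta> x y * g (x, y) \<partial>\<nu>) / 2 ^ d)"
      by simp
  qed
  also have "\<dots> = ennreal (\<Sum>x\<in>cube d. (\<integral>y. glm_dens \<nu> d \<theta> x y * g (x, y) \<partial>\<nu>) / 2 ^ d)"
    using pos by (intro sum_ennreal)
  finally show "(\<integral>\<^sup>+ z. ennreal (g z) \<partial>joint \<nu> d \<theta>)
      = ennreal (\<Sum>x\<in>cube d. (\<integral>y. glm_dens \<nu> d \<theta> x y * g (x, y) \<partial>\<nu>) / 2 ^ d)" .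
  show "0 \<le> (\<Sum>x\<in>cube d. (\<integral>y. glm_dens \<nu> d \<theta> x y * g (x, y) \<partial>\<nu>) / 2 ^ d)"
    using pos by (intro sum_nonneg)
qed (use g nn in auto)

lemma has_bochner_integral_joint:
  fixes g :: "(nat \<Rightarrow> real) \<times> real \<Rightarrow> real"
  assumes g[measurable]: "g \<in> borel_measurable (XY \<nu>)"
    and int: "\<And>x. x \<in> cube d \<Longrightarrow> integrable \<nu> (\<lambda>y. glm_dens \<nu> d \<theta> x y * g (x, y))"
  shows "has_bochner_integral (joint \<nu> d \<theta>) g
    (\<Sum>x\<in>cube d. (\<integral>y. glm_dens \<nu> d \<theta> x y * g (x, y) \<partial>\<nu>) / 2 ^ d)"
proof -
  define gp where "gp z = max 0 (g z)" for z
  define gn where "gn z = max 0 (- g z)" for z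
  have [measurable]: "gp \<in> borel_measurable (XY \<nu>)" "gn \<in> borel_measurable (XY \<nu>)"
    unfolding gp_def gn_def by measurable
  have ip: "integrable \<nu> (\<lambda>y. glm_dens \<nu> d \<theta> x y * gp (x, y))"
    and "in": "integrable \<nu> (\<lambda>y. glm_dens \<nu> d \<theta> x y * gn (x, y))" if x: "x \<in> cube d" for x
  proof -
    have [measurable]: "(\<lambda>y. gp (x, y)) \<in> borel_measurable \<nu>" "(\<lambda>y. gn (x, y)) \<in> borel_measurable \<nu>"
      by (auto intro: section_XY_measurable)
    show "integrable \<nu> (\<lambda>y. glm_dens \<nu> d \<theta> x y * gp (x, y))"
      by (rule Bochner_Integration.integrable_bound[OF int[OF x]])
         (measurable, auto simp: gp_def abs_mult glm_pos less_imp_le intro!: mult_left_mono)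
    show "integrable \<nu> (\<lambda>y. glm_dens \<nu> d \<theta> x y * gn (x, y))"
      by (rule Bochner_Integration.integrable_bound[OF int[OF x]])
         (measurable, auto simp: gn_def abs_mult glm_pos less_imp_le intro!: mult_left_mono)
  qed
  have "has_bochner_integral (joint \<nu> d \<theta>) (\<lambda>z. gp z - gn z)
      ((\<Sum>x\<in>cube d. (\<integral>y. glm_dens \<nu> d \<theta> x y * gp (x, y) \<partial>\<nu>) / 2 ^ d)
        - (\<Sum>x\<in>cube d. (\<integral>y. glm_dens \<nu> d \<theta> x y * gn (x, y) \<partial>\<nu>) / 2 ^ d))"
    by (intro has_bochner_integral_diff has_bochner_integral_joint_nonneg ip "in") (auto simp: gp_def gn_def)
  moreover have "gp z - gn z = g z" for z by (auto simp: gp_def gn_def)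
  moreover have "(\<Sum>x\<in>cube d. (\<integral>y. glm_dens \<nu> d \<theta> x y * gp (x, y) \<partial>\<nu>) / 2 ^ d)
        - (\<Sum>x\<in>cube d. (\<integral>y. glm_dens \<nu> d \<theta> x y * gn (x, y) \<partial>\<nu>) / 2 ^ d)
      = (\<Sum>x\<in>cube d. (\<integral>y. glm_dens \<nu> d \<theta> x y * g (x, y) \<partial>\<nu>) / 2 ^ d)"
    unfolding sum_subtractf[symmetric]
  proof (intro sum.cong refl)
    fix x assume x: "x \<in> cube d"
    have "(\<integral>y. glm_dens \<nu> d \<theta> x y * gp (x, y) \<partial>\<nu>) - (\<integral>y. glm_dens \<nu> d \<theta> x y * gn (x, y) \<partial>\<nu>)
        = (\<integral>y. glm_dens \<nu> d \<theta> x y * gp (x, y) - glm_dens \<nu> d \<theta> x y * gn (x, y) \<partial>\<nu>)"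
      using ip[OF x] "in"[OF x] by simp
    also have "\<dots> = (\<integral>y. glm_dens \<nu> d \<theta> x y * g (x, y) \<partial>\<nu>)"
      by (intro Bochner_Integration.integral_cong) (auto simp: gp_def gn_def max_def)
    finally show "(\<integral>y. glm_dens \<nu> d \<theta> x y * gp (x, y) \<partial>\<nu>) / 2 ^ d
        - (\<integral>y. glm_dens \<nu> d \<theta> x y * gn (x, y) \<partial>\<nu>) / 2 ^ d
        = (\<integral>y. glm_dens \<nu> d \<theta> x y * g (x, y) \<partial>\<nu>) / 2 ^ d"
      by (simp flip: diff_divide_distrib)
  qed
  ultimately show ?thesis by simp
qed

lemma prob_space_joint:
  assumes "admissible d \<theta>"
  shows "prob_space (joint \<nu> d \<theta>)"
proof
  have "has_bochner_integral (joint \<nu> d \<theta>) (\<lambda>_. 1 :: real)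
      (\<Sum>x\<in>cube d. (\<integral>y. glm_dens \<nu> d \<theta> x y * 1 \<partial>\<nu>) / 2 ^ d)"
    using assms by (intro has_bochner_integral_joint) (auto simp: integrable_glm)
  also have "(\<Sum>x\<in>cube d. (\<integral>y. glm_dens \<nu> d \<theta> x y * 1 \<partial>\<nu>) / 2 ^ d) = 1"
    using assms by (simp add: integral_glm card_cube)
  finally have "(\<integral>\<^sup>+ z. ennreal 1 \<partial>joint \<nu> d \<theta>) = ennreal 1"
    by (subst nn_integral_eq_integral) (auto simp: has_bochner_integral_iff)
  then show "emeasure (joint \<nu> d \<theta>) (space (joint \<nu> d \<theta>)) = 1" by simp
qed

lemma AE_joint_cube: "AE z in joint \<nu> d \<theta>. fst z \<in> cube d"
  unfolding joint_def AE_density[OF joint_weight_measurable]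
  by (intro AE_I2) (auto simp: indicator_def of_bool_def split: if_splits)

section \<open>Excess risk and Hellinger distance\<close>

lemma integrable_sqrt_mult:
  fixes p q :: "real \<Rightarrow> real"
  assumes "integrable \<nu> p" "integrable \<nu> q" "\<And>y. 0 \<le> p y" "\<And>y. 0 \<le> q y"
  shows "integrable \<nu> (\<lambda>y. sqrt (p y * q y))"
proof (rule Bochner_Integration.integrable_bound)
  show "integrable \<nu> (\<lambda>y. p y + q y)" using assms by simp
  have "sqrt (p y * q y) \<le> p y + q y" for y
  proof (rule real_le_lsqrt)
    show "p y * q y \<le> (p y + q y)\<^sup>2"
      using assms(3,4)[of y] by (simp add: power2_eq_square algebra_simps)
  qed (use assms in auto)
  then show "AE y in \<nu>. norm (sqrt (p y * q y)) \<le> norm (p y + q y)"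
    using assms by (simp add: abs_of_nonneg)
qed (use assms in \<open>auto simp: borel_measurable_integrable\<close>)

lemma cond_densD:
  assumes "cond_dens \<nu> d p" "x \<in> cube d"
  shows "p x \<in> borel_measurable \<nu>" "0 \<le> p x y" "integrable \<nu> (p x)" "(\<integral>y. p x y \<partial>\<nu>) = 1"
proof -
  show m: "p x \<in> borel_measurable \<nu>" and nn: "0 \<le> p x y" for y
    using assms by (auto simp: cond_dens_def)
  have "has_bochner_integral \<nu> (p x) 1"
    using assms m nn by (intro has_bochner_integral_nn_integral) (auto simp: cond_dens_def)
  then show "integrable \<nu> (p x)" "(\<integral>y. p x y \<partial>\<nu>) = 1"
    by (auto simp: has_bochner_integral_iff)
qed

lemma integrable_glm_log:
  assumes "admissible d \<theta>" "x \<in> cube d"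
  shows "integrable \<nu> (\<lambda>y. glm_dens \<nu> d \<theta> x y * - ln (glm_dens \<nu> d \<theta> x y))"
proof -
  define u where "u = dotp d \<theta> x"
  have u: "\<bar>u\<bar> < \<epsilon>" using assms by (auto simp: admissible_def u_def)
  have "integrable \<nu> (\<lambda>y. - (u * (y ^ 1 * exp (y * u)) / exp (A u)) + A u * exp (y * u - A u))"
    using integrable_power_exp[OF u, of 1] integrable_dens[OF u]
    by (intro Bochner_Integration.integrable_add integrable_minus integrable_divide integrable_mult_right)
  also have "(\<lambda>y. - (u * (y ^ 1 * exp (y * u)) / exp (A u)) + A u * exp (y * u - A u))
      = (\<lambda>y. glm_dens \<nu> d \<theta> x y * - ln (glm_dens \<nu> d \<theta> x y))"
    unfolding glm_dens_def u_def[symmetric] ln_exp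
    by (simp add: exp_diff fun_eq_iff field_simps)
  finally show ?thesis .
qed

text \<open>The conditional entropy of the response relative to \<open>\<nu>\<close>, that is, the
  risk of the true density. It is finite because the log-density is affine in
  \<open>y\<close>.\<close>

definition entropy_risk :: "nat \<Rightarrow> (nat \<Rightarrow> real) \<Rightarrow> real" where
  "entropy_risk d \<theta> = (\<Sum>x\<in>cube d. (\<integral>y. glm_dens \<nu> d \<theta> x y * - ln (glm_dens \<nu> d \<theta> x y) \<partial>\<nu>) / 2 ^ d)"

lemma risk_glm:
  assumes "admissible d \<theta>"
  shows "risk \<nu> d \<theta> (glm_dens \<nu> d \<theta>) = ereal (entropy_risk d \<theta>)"
proof -
  define g where "g z = - ln (glm_dens \<nu> d \<theta> (fst z) (snd z))" for z
  have g: "g \<in> borel_measurable (XY \<nu>)"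
    using glm_XY_measurable[of d \<theta>] unfolding g_def by measurable
  have hb: "has_bochner_integral (joint \<nu> d \<theta>) g (entropy_risk d \<theta>)"
    using has_bochner_integral_joint[OF g, of d \<theta>] integrable_glm_log[OF assms]
    by (simp add: entropy_risk_def g_def)
  have "(\<lambda>(x, y). neglog (glm_dens \<nu> d \<theta> x y)) z = ereal (g z)" for z
    using glm_pos[of d \<theta> "fst z" "snd z"] by (simp add: neglog_def g_def case_prod_beta)
  then show ?thesis
    unfolding risk_def using hb by (subst eexp_ereal[where g=g]) (auto simp: has_bochner_integral_iff)
qed

text \<open>The inequality \<open>ln s \<le> s - 1\<close> at the square root of the density ratio
  gives a pointwise minorant of the log-loss. The minorant is integrable even when the loss itself
  is not, and its mean is the entropy plus the squared Hellinger distance.\<close>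

lemma risk_ge_hellinger:
  assumes adm: "admissible d \<theta>" and p: "cond_dens \<nu> d p"
  shows "ereal (entropy_risk d \<theta> + (\<Sum>x\<in>cube d. (2 - 2 * (\<integral>y. sqrt (p x y * glm_dens \<nu> d \<theta> x y) \<partial>\<nu>)) / 2 ^ d))
    \<le> risk \<nu> d \<theta> p"
proof -
  let ?q = "glm_dens \<nu> d \<theta>"
  define f where "f x y = - ln (?q x y) + (2 - 2 * sqrt (p x y / ?q x y))" for x y
  \<comment> \<open>Off the cube nothing is known about \<open>p\<close>. The joint law gives no
    mass there, so the value 0 is harmless and makes \<open>g\<close> jointly measurable.\<close>
  define g where "g z = (if fst z \<in> cube d then f (fst z) (snd z) else 0)" for z
  have fm: "f x \<in> borel_measurable \<nu>" if "x \<in> cube d" for x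
    using cond_densD(1)[OF p that] unfolding f_def by measurable
  have g: "g \<in> borel_measurable (XY \<nu>)"
    unfolding g_def using fm by (intro measurable_XY_finite_support) auto
  have qf: "?q x y * f x y = ?q x y * - ln (?q x y) + (2 * ?q x y - 2 * sqrt (p x y * ?q x y))"
    if "x \<in> cube d" for x y
  proof -
    have "?q x y * sqrt (p x y / ?q x y) = sqrt (?q x y * ?q x y) * sqrt (p x y / ?q x y)"
      using glm_pos[of d \<theta> x y] by simp
    also have "\<dots> = sqrt (p x y * ?q x y)"
      using glm_pos[of d \<theta> x y] by (simp only: real_sqrt_mult[symmetric]) (simp add: mult.commute)
    finally show ?thesis by (simp add: f_def algebra_simps)
  qed
  have sq: "integrable \<nu> (\<lambda>y. sqrt (p x y * ?q x y))" if "x \<in> cube d" for x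
    using cond_densD[OF p that] integrable_glm[OF adm that] glm_pos[THEN less_imp_le]
    by (intro integrable_sqrt_mult)
  have int: "integrable \<nu> (\<lambda>y. ?q x y * g (x, y))" if x: "x \<in> cube d" for x
    using x integrable_glm_log[OF adm x] integrable_glm[OF adm x] sq[OF x]
    by (simp add: g_def qf del: mult_minus_right)
  have val: "(\<integral>y. ?q x y * g (x, y) \<partial>\<nu>)
      = (\<integral>y. ?q x y * - ln (?q x y) \<partial>\<nu>) + (2 - 2 * (\<integral>y. sqrt (p x y * ?q x y) \<partial>\<nu>))"
    if x: "x \<in> cube d" for x
    using x integrable_glm_log[OF adm x] integrable_glm[OF adm x] sq[OF x] integral_glm[OF adm x]
    by (simp add: g_def qf del: mult_minus_right)
  have hb: "has_bochner_integral (joint \<nu> d \<theta>) g (entropy_risk d \<theta> +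
      (\<Sum>x\<in>cube d. (2 - 2 * (\<integral>y. sqrt (p x y * ?q x y) \<partial>\<nu>)) / 2 ^ d))"
  proof -
    have "(\<Sum>x\<in>cube d. (\<integral>y. ?q x y * g (x, y) \<partial>\<nu>) / 2 ^ d) = entropy_risk d \<theta> +
        (\<Sum>x\<in>cube d. (2 - 2 * (\<integral>y. sqrt (p x y * ?q x y) \<partial>\<nu>)) / 2 ^ d)"
      unfolding entropy_risk_def sum.distrib[symmetric] add_divide_distrib[symmetric]
      by (intro sum.cong refl) (simp only: val)
    then show ?thesis
      using has_bochner_integral_joint[OF g int] by simp
  qed
  have "ereal (g z) \<le> (\<lambda>(x, y). neglog (p x y)) z" if "fst z \<in> cube d" for z
  proof (cases "p (fst z) (snd z) \<le> 0")
    case False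
    define a where "a = p (fst z) (snd z)"
    define b where "b = ?q (fst z) (snd z)"
    have ab: "0 < a" "0 < b" using False by (auto simp: a_def b_def glm_pos)
    have "ln (sqrt (a / b)) \<le> sqrt (a / b) - 1"
      using ab by (intro ln_le_minus_one) auto
    moreover have "ln (sqrt (a / b)) = (ln a - ln b) / 2"
      using ab by (simp add: ln_sqrt ln_div)
    ultimately have "- ln b + (2 - 2 * sqrt (a / b)) \<le> - ln a" by (simp add: field_simps)
    then show ?thesis
      using that False by (simp add: g_def f_def neglog_def case_prod_beta a_def b_def)
  qed (simp add: neglog_def case_prod_beta)
  then have "AE z in joint \<nu> d \<theta>. ereal (g z) \<le> (\<lambda>(x, y). neglog (p x y)) z"
    using AE_joint_cube[of d \<theta>] by (auto elim: eventually_mono)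
  then have "ereal (integral\<^sup>L (joint \<nu> d \<theta>) g) \<le> risk \<nu> d \<theta> p"
    unfolding risk_def using hb by (intro eexp_ge_integral) (auto simp: has_bochner_integral_iff)
  then show ?thesis
    using hb by (simp add: has_bochner_integral_iff)
qed

text \<open>The optimal risk is subtracted, so an upper bound for it suffices, and the true density
  is itself a competitor in the infimum.\<close>

lemma excess_risk_ge_hellinger:
  assumes adm: "admissible d \<theta>" and p: "cond_dens \<nu> d p"
  shows "ereal (\<Sum>x\<in>cube d. (2 - 2 * (\<integral>y. sqrt (p x y * glm_dens \<nu> d \<theta> x y) \<partial>\<nu>)) / 2 ^ d)
    \<le> risk \<nu> d \<theta> p - risk_star \<nu> d \<theta>"
proof -
  have "risk_star \<nu> d \<theta> \<le> ereal (entropy_risk d \<theta>)"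
    unfolding risk_star_def risk_glm[OF adm, symmetric]
    using cond_dens_glm[OF adm] by (intro INF_lower) auto
  then have "ereal (entropy_risk d \<theta> + (\<Sum>x\<in>cube d. (2 - 2 * (\<integral>y. sqrt (p x y * glm_dens \<nu> d \<theta> x y) \<partial>\<nu>)) / 2 ^ d))
      - ereal (entropy_risk d \<theta>) \<le> risk \<nu> d \<theta> p - risk_star \<nu> d \<theta>"
    by (intro ereal_minus_mono risk_ge_hellinger adm p)
  then show ?thesis by simp
qed

section \<open>Bessel's inequality for square-root densities\<close>

lemma score_projection:
  assumes w[measurable]: "w \<in> borel_measurable \<nu>" and w2: "integrable \<nu> (\<lambda>y. (w y)\<^sup>2)"
  shows "integrable \<nu> (\<lambda>y. score y * w y)"
    and "(\<integral>y. score y * w y \<partial>\<nu>)\<^sup>2 \<le> (\<integral>y. (w y)\<^sup>2 \<partial>\<nu>)"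
proof -
  show int: "integrable \<nu> (\<lambda>y. score y * w y)"
  proof (rule Bochner_Integration.integrable_bound)
    show "integrable \<nu> (\<lambda>y. (score y)\<^sup>2 + (w y)\<^sup>2)"
      using w2 integrable_score_sq by simp
    have "\<bar>score y * w y\<bar> \<le> (score y)\<^sup>2 + (w y)\<^sup>2" for y
    proof -
      have "2 * (\<bar>score y\<bar> * \<bar>w y\<bar>) \<le> (score y)\<^sup>2 + (w y)\<^sup>2"
        using sum_squares_bound[of "\<bar>score y\<bar>" "\<bar>w y\<bar>"] by (simp add: mult.assoc)
      moreover have "0 \<le> \<bar>score y\<bar> * \<bar>w y\<bar>" by simp
      ultimately show ?thesis unfolding abs_mult by linarith
    qed
    then show "AE y in \<nu>. norm (score y * w y) \<le> norm ((score y)\<^sup>2 + (w y)\<^sup>2)"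
      by simp
  qed measurable
  define c where "c = (\<integral>y. score y * w y \<partial>\<nu>)"
  have "0 \<le> (\<integral>y. (w y - c * score y)\<^sup>2 \<partial>\<nu>)" by simp
  also have "\<dots> = (\<integral>y. (w y)\<^sup>2 - 2 * c * (score y * w y) + c\<^sup>2 * (score y)\<^sup>2 \<partial>\<nu>)"
    by (intro Bochner_Integration.integral_cong) (auto simp: power2_eq_square algebra_simps)
  also have "\<dots> = (\<integral>y. (w y)\<^sup>2 \<partial>\<nu>) - c\<^sup>2"
    using int w2 integrable_score_sq integral_score_sq
    by (simp flip: c_def) (simp add: power2_eq_square)
  finally show "(\<integral>y. score y * w y \<partial>\<nu>)\<^sup>2 \<le> (\<integral>y. (w y)\<^sup>2 \<partial>\<nu>)"
    by (simp add: c_def)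
qed

text \<open>The counterpart of \<open>coef\<close> for an arbitrary predictor. Applied to the
  prediction made from a sample, it is a real-valued estimator of
  \<open>coef d j \<theta>\<close>.\<close>

definition pcoef :: "nat \<Rightarrow> nat \<Rightarrow> ((nat \<Rightarrow> real) \<Rightarrow> real \<Rightarrow> real) \<Rightarrow> real" where
  "pcoef d j p = (\<Sum>x\<in>cube d. x j * (\<integral>y. score y * sqrt (p x y) \<partial>\<nu>) / 2 ^ d)"

lemma pcoef_glm: "pcoef d j (glm_dens \<nu> d \<theta>) = coef d j \<theta>"
  by (simp add: pcoef_def coef_def \<psi>_def glm_dens_def)

text \<open>Bessel's inequality is used twice: over the cube for the coordinate functions, then for
  each \<open>x\<close> in the response variable along the score. What remains is the squared L2
  distance of the square-root densities.\<close>

lemma hellinger_ge_pcoef: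
  assumes p: "cond_dens \<nu> d p" and q: "cond_dens \<nu> d q"
  shows "(\<Sum>j<d. (pcoef d j p - pcoef d j q)\<^sup>2)
    \<le> (\<Sum>x\<in>cube d. (2 - 2 * (\<integral>y. sqrt (p x y * q x y) \<partial>\<nu>)) / 2 ^ d)"
proof -
  define c where "c x = (\<integral>y. score y * sqrt (p x y) \<partial>\<nu>) - (\<integral>y. score y * sqrt (q x y) \<partial>\<nu>)" for x
  have "pcoef d j p - pcoef d j q = (\<Sum>x\<in>cube d. x j * c x / 2 ^ d)" for j
    by (simp add: pcoef_def c_def right_diff_distrib diff_divide_distrib sum_subtractf)
  then have "(\<Sum>j<d. (pcoef d j p - pcoef d j q)\<^sup>2) \<le> (\<Sum>x\<in>cube d. (c x)\<^sup>2 / 2 ^ d)"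
    by (simp add: cube_bessel)
  also have "\<dots> \<le> (\<Sum>x\<in>cube d. (2 - 2 * (\<integral>y. sqrt (p x y * q x y) \<partial>\<nu>)) / 2 ^ d)"
  proof (intro sum_mono divide_right_mono)
    fix x assume x: "x \<in> cube d"
    note P = cond_densD[OF p x] and Q = cond_densD[OF q x]
    note [measurable] = P(1) Q(1)
    define w where "w y = sqrt (p x y) - sqrt (q x y)" for y
    have w2: "(w y)\<^sup>2 = p x y + q x y - 2 * sqrt (p x y * q x y)" for y
      using P(2)[of y] Q(2)[of y] by (simp add: w_def power2_diff real_sqrt_mult)
    have iw: "integrable \<nu> (\<lambda>y. (w y)\<^sup>2)"
      unfolding w2 using P Q
      by (intro Bochner_Integration.integrable_add Bochner_Integration.integrable_diff
          integrable_mult_right integrable_sqrt_mult)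
    have "integrable \<nu> (\<lambda>y. score y * sqrt (p x y))" "integrable \<nu> (\<lambda>y. score y * sqrt (q x y))"
      using P Q by (auto intro!: score_projection(1))
    then have "c x = (\<integral>y. score y * w y \<partial>\<nu>)"
      by (simp add: c_def w_def right_diff_distrib)
    also have "\<dots>\<^sup>2 \<le> (\<integral>y. (w y)\<^sup>2 \<partial>\<nu>)"
      using iw by (intro score_projection(2)) (simp_all add: w_def)
    also have "\<dots> = 2 - 2 * (\<integral>y. sqrt (p x y * q x y) \<partial>\<nu>)"
      unfolding w2 using P Q integrable_sqrt_mult[of "p x" "q x"] by simp
    finally show "(c x)\<^sup>2 \<le> 2 - 2 * (\<integral>y. sqrt (p x y * q x y) \<partial>\<nu>)" .
  qed simp
  finally show ?thesis .
qed

text \<open>A bound uniform over all predictors. It makes the squared coefficient errors integrable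
  under every sample law, whatever the risk of the prediction.\<close>

lemma pcoef_dist_le_2:
  assumes p: "cond_dens \<nu> d p" and q: "cond_dens \<nu> d q"
  shows "(\<Sum>j<d. (pcoef d j p - pcoef d j q)\<^sup>2) \<le> 2"
proof -
  have "(\<Sum>x\<in>cube d. (2 - 2 * (\<integral>y. sqrt (p x y * q x y) \<partial>\<nu>)) / 2 ^ d) \<le> (\<Sum>x\<in>cube d. 2 / 2 ^ d)"
    using cond_densD(2)[OF p] cond_densD(2)[OF q]
    by (intro sum_mono divide_right_mono) (auto intro!: Bochner_Integration.integral_nonneg)
  also have "\<dots> = 2" by (simp add: card_cube)
  finally show ?thesis using hellinger_ge_pcoef[OF p q] by simp
qed

end

section \<open>Lower bound over the cube of parameters\<close>

context exp_family
begin

section \<open>Coefficients of an estimator as functions of the sample\<close>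

lemma sets_PiM_joint [measurable_cong]:
  "sets (PiM {..<n} (\<lambda>_. joint \<nu> d \<theta>)) = sets (sample_space \<nu> n)"
  unfolding sample_space_def by (intro sets_PiM_cong) auto

lemma space_PiM_joint: "space (PiM {..<n} (\<lambda>_. joint \<nu> d \<theta>)) = space (sample_space \<nu> n)"
  by (rule sets_eq_imp_space_eq[OF sets_PiM_joint])

lemma pcoef_measurable:
  assumes "ph \<in> estimators \<nu> d n"
  shows "(\<lambda>S. pcoef d j (ph S)) \<in> borel_measurable (sample_space \<nu> n)"
  unfolding pcoef_def
proof (intro borel_measurable_sum borel_measurable_divide borel_measurable_times borel_measurable_const)
  fix x assume x: "x \<in> cube d"
  have [measurable]: "(\<lambda>(S, y). ph S x y) \<in> borel_measurable (sample_space \<nu> n \<Otimes>\<^sub>M \<nu>)"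
    using assms x by (auto simp: estimators_def)
  show "(\<lambda>S. \<integral>y. score y * sqrt (ph S x y) \<partial>\<nu>) \<in> borel_measurable (sample_space \<nu> n)"
    by (rule borel_measurable_lebesgue_integral) measurable
qed

lemma estimator_cond_dens:
  "ph \<in> estimators \<nu> d n \<Longrightarrow> S \<in> space (sample_space \<nu> n) \<Longrightarrow> cond_dens \<nu> d (ph S)"
  by (auto simp: estimators_def)

lemma prob_space_PiM_joint:
  "admissible d \<theta> \<Longrightarrow> prob_space (PiM {..<n} (\<lambda>_. joint \<nu> d \<theta>))"
  by (intro prob_space_PiM prob_space_joint)

lemma integrable_pcoef_sq:
  assumes ph: "ph \<in> estimators \<nu> d n" and adm: "admissible d \<theta>" "admissible d \<theta>'" and "j < d"
  shows "integrable (PiM {..<n} (\<lambda>_. joint \<nu> d \<theta>)) (\<lambda>S. (pcoef d j (ph S) - coef d j \<theta>')\<^sup>2)"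
proof -
  interpret P: prob_space "PiM {..<n} (\<lambda>_. joint \<nu> d \<theta>)"
    by (rule prob_space_PiM_joint[OF adm(1)])
  have [measurable]: "(\<lambda>S. pcoef d j (ph S)) \<in> borel_measurable (sample_space \<nu> n)"
    by (rule pcoef_measurable[OF ph])
  show ?thesis
  proof (rule P.integrable_const_bound[where B=2])
    have "(pcoef d j (ph S) - coef d j \<theta>')\<^sup>2 \<le> 2" if "S \<in> space (sample_space \<nu> n)" for S
    proof -
      have "(pcoef d j (ph S) - coef d j \<theta>')\<^sup>2 \<le> (\<Sum>j<d. (pcoef d j (ph S) - coef d j \<theta>')\<^sup>2)"
        using \<open>j < d\<close> by (intro member_le_sum) auto
      also have "\<dots> \<le> 2"
        using pcoef_dist_le_2[OF estimator_cond_dens[OF ph that] cond_dens_glm[OF adm(2)]]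
        by (simp add: pcoef_glm)
      finally show ?thesis .
    qed
    then show "AE S in PiM {..<n} (\<lambda>_. joint \<nu> d \<theta>). norm ((pcoef d j (ph S) - coef d j \<theta>')\<^sup>2) \<le> 2"
      by (intro AE_I2) (simp add: space_PiM_joint)
  qed measurable
qed

text \<open>The sum of squared errors is bounded, hence an integrable minorant of the excess risk,
  which is what \<open>eexp_ge_integral\<close> asks for.\<close>

lemma expected_excess_ge:
  assumes ph: "ph \<in> estimators \<nu> d n" and adm: "admissible d \<theta>"
  shows "ereal (\<Sum>j<d. \<integral>S. (pcoef d j (ph S) - coef d j \<theta>)\<^sup>2 \<partial>PiM {..<n} (\<lambda>_. joint \<nu> d \<theta>))
    \<le> expected_excess \<nu> d n \<theta> ph"
proof -
  let ?P = "PiM {..<n} (\<lambda>_. joint \<nu> d \<theta>)"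
  have int: "integrable ?P (\<lambda>S. (pcoef d j (ph S) - coef d j \<theta>)\<^sup>2)" if "j < d" for j
    using ph adm that by (intro integrable_pcoef_sq)
  have "ereal (\<integral>S. (\<Sum>j<d. (pcoef d j (ph S) - coef d j \<theta>)\<^sup>2) \<partial>?P) \<le> expected_excess \<nu> d n \<theta> ph"
    unfolding expected_excess_def
  proof (intro eexp_ge_integral AE_I2)
    show "integrable ?P (\<lambda>S. \<Sum>j<d. (pcoef d j (ph S) - coef d j \<theta>)\<^sup>2)"
      using int by (intro Bochner_Integration.integrable_sum) auto
    fix S assume "S \<in> space ?P"
    then have p: "cond_dens \<nu> d (ph S)"
      using estimator_cond_dens[OF ph] by (simp add: space_PiM_joint)
    have "ereal (\<Sum>j<d. (pcoef d j (ph S) - coef d j \<theta>)\<^sup>2)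
        \<le> ereal (\<Sum>x\<in>cube d. (2 - 2 * (\<integral>y. sqrt (ph S x y * glm_dens \<nu> d \<theta> x y) \<partial>\<nu>)) / 2 ^ d)"
      using hellinger_ge_pcoef[OF p cond_dens_glm[OF adm]] by (simp add: pcoef_glm)
    also have "\<dots> \<le> risk \<nu> d \<theta> (ph S) - risk_star \<nu> d \<theta>"
      by (rule excess_risk_ge_hellinger[OF adm p])
    finally show "ereal (\<Sum>j<d. (pcoef d j (ph S) - coef d j \<theta>)\<^sup>2)
        \<le> risk \<nu> d \<theta> (ph S) - risk_star \<nu> d \<theta>" .
  qed
  also have "(\<integral>S. (\<Sum>j<d. (pcoef d j (ph S) - coef d j \<theta>)\<^sup>2) \<partial>?P)
      = (\<Sum>j<d. \<integral>S. (pcoef d j (ph S) - coef d j \<theta>)\<^sup>2 \<partial>?P)"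
    using int by (intro Bochner_Integration.integral_sum) auto
  finally show ?thesis .
qed

section \<open>Likelihood ratios and Hellinger affinity\<close>

definition affinity :: "nat \<Rightarrow> (nat \<Rightarrow> real) \<Rightarrow> (nat \<Rightarrow> real) \<Rightarrow> real" where
  "affinity d \<theta> \<theta>' = (\<Sum>x\<in>cube d. exp (A ((dotp d \<theta> x + dotp d \<theta>' x) / 2)
     - A (dotp d \<theta> x) / 2 - A (dotp d \<theta>' x) / 2) / 2 ^ d)"

definition lratio :: "nat \<Rightarrow> (nat \<Rightarrow> real) \<Rightarrow> (nat \<Rightarrow> real) \<Rightarrow> (nat \<Rightarrow> real) \<times> real \<Rightarrow> real" where
  "lratio d \<theta> \<theta>' z = glm_dens \<nu> d \<theta>' (fst z) (snd z) / glm_dens \<nu> d \<theta> (fst z) (snd z)"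

lemma lratio_pos: "0 < lratio d \<theta> \<theta>' z"
  by (simp add: lratio_def glm_pos)

lemma lratio_measurable [measurable]: "lratio d \<theta> \<theta>' \<in> borel_measurable (XY \<nu>)"
  unfolding lratio_def using glm_XY_measurable by (intro borel_measurable_divide)

lemma glm_lratio: "glm_dens \<nu> d \<theta> x y * lratio d \<theta> \<theta>' (x, y) = glm_dens \<nu> d \<theta>' x y"
  using glm_pos[of d \<theta> x y] by (simp add: lratio_def)

text \<open>Model densities are strictly positive, so the law at one parameter has the likelihood
  ratio as density relative to the law at the other. With a probability measure as reference,
  products over the sample can be formed by \<open>PiM_density\<close>.\<close>

lemma joint_eq_density:
  "joint \<nu> d \<theta>' = density (joint \<nu> d \<theta>) (\<lambda>z. ennreal (lratio d \<theta> \<theta>' z))"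
proof -
  let ?w = "\<lambda>\<theta> (x, y). ennreal (indicator (cube d) x / 2 ^ d * glm_dens \<nu> d \<theta> x y)"
  have "density (joint \<nu> d \<theta>) (\<lambda>z. ennreal (lratio d \<theta> \<theta>' z))
      = density (XY \<nu>) (\<lambda>z. ?w \<theta> z * ennreal (lratio d \<theta> \<theta>' z))"
    unfolding joint_def by (intro density_density_eq) measurable
  also have "(\<lambda>z. ?w \<theta> z * ennreal (lratio d \<theta> \<theta>' z)) = ?w \<theta>'"
    using lratio_pos[THEN less_imp_le] glm_pos[THEN less_imp_le]
    by (auto simp: fun_eq_iff mult.assoc glm_lratio simp flip: ennreal_mult)
  finally show ?thesis by (simp add: joint_def)
qed

lemma has_bochner_integral_lratio:
  assumes "admissible d \<theta>'"
  shows "has_bochner_integral (joint \<nu> d \<theta>) (lratio d \<theta> \<theta>') 1"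
  using has_bochner_integral_joint[of "lratio d \<theta> \<theta>'" d \<theta>] integrable_glm[OF assms] integral_glm[OF assms]
  by (simp add: glm_lratio card_cube)

text \<open>The geometric mean of two members of an exponential family is a multiple of the member
  at the midpoint of their natural parameters. The multiple is the summand in
  \<open>affinity\<close>.\<close>

lemma has_bochner_integral_sqrt_lratio:
  assumes adm: "admissible d \<theta>" "admissible d \<theta>'"
  shows "has_bochner_integral (joint \<nu> d \<theta>) (\<lambda>z. sqrt (lratio d \<theta> \<theta>' z)) (affinity d \<theta> \<theta>')"
proof -
  define v where "v x = (dotp d \<theta> x + dotp d \<theta>' x) / 2" for x
  define e where "e x = exp (A (v x) - A (dotp d \<theta> x) / 2 - A (dotp d \<theta>' x) / 2)" for x
  have v: "\<bar>v x\<bar> < \<epsilon>" if "x \<in> cube d" for x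
    using adm that unfolding admissible_def v_def by (auto simp: abs_less_iff field_simps) (smt (verit))+
  have eq: "glm_dens \<nu> d \<theta> x y * sqrt (lratio d \<theta> \<theta>' (x, y)) = e x * exp (y * v x - A (v x))" for x y
  proof -
    have "sqrt (lratio d \<theta> \<theta>' (x, y)) = exp (((y * dotp d \<theta>' x - A (dotp d \<theta>' x)) - (y * dotp d \<theta> x - A (dotp d \<theta> x))) / 2)"
      by (rule real_sqrt_unique) (auto simp: lratio_def glm_dens_def simp flip: exp_diff exp_double)
    then show ?thesis
      by (simp add: glm_dens_def e_def v_def flip: exp_add) (simp add: field_simps)
  qed
  have m: "(\<lambda>z. sqrt (lratio d \<theta> \<theta>' z)) \<in> borel_measurable (XY \<nu>)" by measurable
  have "has_bochner_integral (joint \<nu> d \<theta>) (\<lambda>z. sqrt (lratio d \<theta> \<theta>' z))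
      (\<Sum>x\<in>cube d. (\<integral>y. glm_dens \<nu> d \<theta> x y * sqrt (lratio d \<theta> \<theta>' (x, y)) \<partial>\<nu>) / 2 ^ d)"
    using integrable_dens[OF v] by (intro has_bochner_integral_joint[OF m]) (simp add: eq)
  also have "(\<Sum>x\<in>cube d. (\<integral>y. glm_dens \<nu> d \<theta> x y * sqrt (lratio d \<theta> \<theta>' (x, y)) \<partial>\<nu>) / 2 ^ d)
      = affinity d \<theta> \<theta>'"
    unfolding affinity_def using integral_dens[OF v] by (intro sum.cong refl) (simp add: eq e_def v_def)
  finally show ?thesis .
qed

text \<open>The two-point bound under the law of the sample at \<theta>, with \<open>D\<close> the
  likelihood ratio of the whole sample. By independence the mean of its square root is the
  \<open>n\<close>-th power of the affinity of one observation.\<close>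

lemma two_point_joint:
  assumes ph: "ph \<in> estimators \<nu> d n" and adm: "admissible d \<theta>" "admissible d \<theta>'" and j: "j < d"
  shows "(coef d j \<theta> - coef d j \<theta>')\<^sup>2 * (affinity d \<theta> \<theta>' ^ n)\<^sup>2 / 2
    \<le> (\<integral>S. (pcoef d j (ph S) - coef d j \<theta>)\<^sup>2 \<partial>PiM {..<n} (\<lambda>_. joint \<nu> d \<theta>))
     + (\<integral>S. (pcoef d j (ph S) - coef d j \<theta>')\<^sup>2 \<partial>PiM {..<n} (\<lambda>_. joint \<nu> d \<theta>'))"
proof -
  let ?P = "PiM {..<n} (\<lambda>_. joint \<nu> d \<theta>)" and ?P' = "PiM {..<n} (\<lambda>_. joint \<nu> d \<theta>')"
  define L where "L = lratio d \<theta> \<theta>'"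
  define D where "D S = (\<Prod>i<n. L (S i))" for S :: "nat \<Rightarrow> (nat \<Rightarrow> real) \<times> real"
  interpret J: product_sigma_finite "\<lambda>_ :: nat. joint \<nu> d \<theta>"
    using prob_space_joint[OF adm(1)] by (intro product_sigma_finite.intro prob_space_imp_sigma_finite)
  interpret P: prob_space ?P
    by (rule prob_space_PiM_joint[OF adm(1)])
  have L: "integrable (joint \<nu> d \<theta>) L" "(\<integral>z. L z \<partial>joint \<nu> d \<theta>) = 1"
    using has_bochner_integral_lratio[OF adm(2), of \<theta>] by (auto simp: has_bochner_integral_iff L_def)
  have sL: "integrable (joint \<nu> d \<theta>) (\<lambda>z. sqrt (L z))" "(\<integral>z. sqrt (L z) \<partial>joint \<nu> d \<theta>) = affinity d \<theta> \<theta>'"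
    using has_bochner_integral_sqrt_lratio[OF adm] by (auto simp: has_bochner_integral_iff L_def)
  have L0: "0 \<le> L z" for z using lratio_pos[of d \<theta> \<theta>' z] by (simp add: L_def)
  have D0: "0 \<le> D S" for S unfolding D_def using L0 by (intro prod_nonneg) auto
  have sqrt_D: "sqrt (D S) = (\<Prod>i<n. sqrt (L (S i)))" for S
    unfolding D_def by (induction n) (auto simp: real_sqrt_mult)
  have D: "integrable ?P D" "(\<integral>S. D S \<partial>?P) = 1"
    unfolding D_def using J.product_integrable_prod[of "{..<n}" "\<lambda>_. L"] J.product_integral_prod[of "{..<n}" "\<lambda>_. L"] L
    by auto
  have sD: "integrable ?P (\<lambda>S. sqrt (D S))" "(\<integral>S. sqrt (D S) \<partial>?P) = affinity d \<theta> \<theta>' ^ n"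
    unfolding sqrt_D
    using J.product_integrable_prod[of "{..<n}" "\<lambda>_ z. sqrt (L z)"]
      J.product_integral_prod[of "{..<n}" "\<lambda>_ z. sqrt (L z)"] sL
    by auto
  have P': "?P' = density ?P (\<lambda>S. ennreal (D S))"
  proof -
    have "?P' = PiM {..<n} (\<lambda>_. density (joint \<nu> d \<theta>) (\<lambda>z. ennreal (L z)))"
      by (simp add: L_def flip: joint_eq_density)
    also have "\<dots> = density ?P (\<lambda>S. \<Prod>i<n. ennreal (L (S i)))"
    proof (rule PiM_density)
      show "prob_space (density (joint \<nu> d \<theta>) (\<lambda>z. ennreal (L z)))"
        unfolding L_def joint_eq_density[symmetric] by (rule prob_space_joint[OF adm(2)])
      show "(\<lambda>z. ennreal (L z)) \<in> borel_measurable (joint \<nu> d \<theta>)"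
        unfolding L_def by measurable
    qed (auto intro: prob_space_joint adm)
    finally show ?thesis by (simp add: D_def prod_ennreal L0)
  qed
  have Dm: "D \<in> borel_measurable ?P" using D(1) by (rule borel_measurable_integrable)
  have am: "(\<lambda>S. (pcoef d j (ph S) - coef d j \<theta>')\<^sup>2) \<in> borel_measurable ?P"
    using integrable_pcoef_sq[OF ph adm j] by (rule borel_measurable_integrable)
  \<comment> \<open>Integrability is known under the law at \<open>\<theta>'\<close>. The density
    formula carries it over to the law at \<theta>.\<close>
  have i2: "integrable ?P (\<lambda>S. D S * (pcoef d j (ph S) - coef d j \<theta>')\<^sup>2)"
    using integrable_pcoef_sq[OF ph adm(2,2) j] unfolding P'
    by (subst (asm) integrable_real_density) (use Dm am D0 in auto)
  have e2: "(\<integral>S. (pcoef d j (ph S) - coef d j \<theta>')\<^sup>2 \<partial>?P')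
      = (\<integral>S. D S * (pcoef d j (ph S) - coef d j \<theta>')\<^sup>2 \<partial>?P)"
    unfolding P' by (subst integral_real_density) (use Dm am D0 in auto)
  show ?thesis
    unfolding e2 sD(2)[symmetric]
    by (rule P.two_point_bound) (use D0 D sD i2 integrable_pcoef_sq[OF ph adm(1,1) j] in auto)
qed

text \<open>Since \<open>1 + z \<le> exp z\<close>, a lower bound on the log-affinity at each
  \<open>x\<close> passes to the average over the cube.\<close>

lemma affinity_ge:
  assumes "\<And>x. x \<in> cube d \<Longrightarrow> - e \<le> A ((dotp d \<theta> x + dotp d \<theta>' x) / 2)
     - A (dotp d \<theta> x) / 2 - A (dotp d \<theta>' x) / 2"
  shows "1 - e \<le> affinity d \<theta> \<theta>'"
proof -
  have "1 - e = (\<Sum>x\<in>cube d. (1 - e) / 2 ^ d)" by (simp add: card_cube)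
  also have "\<dots> \<le> affinity d \<theta> \<theta>'"
    unfolding affinity_def
  proof (intro sum_mono divide_right_mono)
    fix x assume "x \<in> cube d"
    then show "1 - e \<le> exp (A ((dotp d \<theta> x + dotp d \<theta>' x) / 2) - A (dotp d \<theta> x) / 2 - A (dotp d \<theta>' x) / 2)"
      using assms[of x] exp_ge_add_one_self[of "A ((dotp d \<theta> x + dotp d \<theta>' x) / 2) - A (dotp d \<theta> x) / 2 - A (dotp d \<theta>' x) / 2"]
      by linarith
  qed simp
  finally show ?thesis .
qed

section \<open>Choice of the radius and averaging over the signs\<close>

definition radius :: "nat \<Rightarrow> real" where
  "radius n = 1 / (2 * sqrt V) * (1 / sqrt (real n))"

lemma radius_sq: "0 < n \<Longrightarrow> V * (radius n)\<^sup>2 = 1 / (4 * real n)"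
  using V_pos by (simp add: radius_def power_mult_distrib power_divide)

lemma radius_at_right_0: "filterlim radius (at_right 0) sequentially"
proof (rule tendsto_imp_filterlim_at_right)
  show "\<forall>\<^sub>F n in sequentially. 0 < radius n"
    using eventually_gt_at_top[of 0] by eventually_elim (use V_pos in \<open>simp add: radius_def\<close>)
  have "(\<lambda>n. 1 / sqrt (real n)) \<longlonglongrightarrow> 0"
    by (intro tendsto_divide_0[OF tendsto_const] filterlim_at_top_imp_at_infinity
        filterlim_compose[OF sqrt_at_top] filterlim_real_sequentially)
  then have "(\<lambda>n. 1 / (2 * sqrt V) * (1 / sqrt (real n))) \<longlonglongrightarrow> 1 / (2 * sqrt V) * 0"
    by (intro tendsto_mult tendsto_const)
  then show "radius \<longlonglongrightarrow> 0" by (simp add: radius_def[abs_def])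
qed

text \<open>With separation \<open>1 / (16 * n)\<close> and squared sample affinity at least 1/2,
  the halved product in the two-point bound is \<open>1 / (64 * n)\<close> for a pair of neighbours.
  Averaging over pairs halves it again, hence 1/128 for each coordinate.\<close>

lemma minimax_lower_bound_at:
  assumes n: "0 < n" and ph: "ph \<in> estimators \<nu> d n"
    and adm: "\<And>\<tau>. \<tau> \<in> cube d \<Longrightarrow> admissible d (\<lambda>i. t * \<tau> i)"
    and t: "V * t\<^sup>2 = 1 / (4 * real n)"
    and aff: "\<And>\<tau> j. \<tau> \<in> cube d \<Longrightarrow> j < d \<Longrightarrow> 1 - V * t\<^sup>2 \<le> affinity d (\<lambda>i. t * \<tau> i) (\<lambda>i. t * flip j \<tau> i)"
    and sep: "\<And>\<tau> j. \<tau> \<in> cube d \<Longrightarrow> j < d \<Longrightarrow>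
      V * t\<^sup>2 / 4 \<le> (coef d j (\<lambda>i. t * \<tau> i) - coef d j (\<lambda>i. t * flip j \<tau> i))\<^sup>2"
  shows "\<exists>\<tau>\<in>cube d. ereal (1 / 128 * real d / real n) \<le> expected_excess \<nu> d n (\<lambda>i. t * \<tau> i) ph"
proof -
  define r where "r \<tau> j = (\<integral>S. (pcoef d j (ph S) - coef d j (\<lambda>i. t * \<tau> i))\<^sup>2
    \<partial>PiM {..<n} (\<lambda>_. joint \<nu> d (\<lambda>i. t * \<tau> i)))" for \<tau> j
  have pair: "1 / (64 * real n) \<le> r \<tau> j + r (flip j \<tau>) j" if \<tau>: "\<tau> \<in> cube d" and j: "j < d" for \<tau> j
  proof -
    let ?\<rho> = "affinity d (\<lambda>i. t * \<tau> i) (\<lambda>i. t * flip j \<tau> i)"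
    have small: "1 / (4 * real n) \<le> 1" using n by (simp add: field_simps)
    \<comment> \<open>This is what fixes \<open>V * t\<^sup>2 = 1 / (4 * n)\<close>: one observation
      loses at most that much affinity, and by Bernoulli's inequality \<open>2 * n\<close> factors
      together lose at most half.\<close>
    have "1 / 2 = 1 + real (2 * n) * (- (1 / (4 * real n)))" using n by simp
    also have "\<dots> \<le> (1 + - (1 / (4 * real n))) ^ (2 * n)"
      using small by (intro Bernoulli_inequality) simp
    also have "\<dots> \<le> ?\<rho> ^ (2 * n)"
      using aff[OF \<tau> j] small unfolding t by (intro power_mono) auto
    finally have rho: "1 / 2 \<le> (?\<rho> ^ n)\<^sup>2" by (simp add: power_mult mult.commute)
    have "1 / (64 * real n) = V * t\<^sup>2 / 4 * (1 / 2) / 2" unfolding t by simp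
    also have "\<dots> \<le> (coef d j (\<lambda>i. t * \<tau> i) - coef d j (\<lambda>i. t * flip j \<tau> i))\<^sup>2 * (?\<rho> ^ n)\<^sup>2 / 2"
      by (intro divide_right_mono mult_mono sep[OF \<tau> j] rho) auto
    also have "\<dots> \<le> r \<tau> j + r (flip j \<tau>) j"
      unfolding r_def using \<tau> j by (intro two_point_joint[OF ph] adm flip_in_cube)
    finally show ?thesis .
  qed
  have "2 ^ d * (1 / 128 * real d / real n) = (\<Sum>j<d. 2 ^ d * (1 / (64 * real n)) / 2)" by simp
  also have "\<dots> \<le> (\<Sum>j<d. \<Sum>\<tau>\<in>cube d. r \<tau> j)"
    using pair by (intro sum_mono sum_cube_pairing) auto
  also have "\<dots> = (\<Sum>\<tau>\<in>cube d. \<Sum>j<d. r \<tau> j)" by (rule sum.swap)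
  finally have total: "2 ^ d * (1 / 128 * real d / real n) \<le> (\<Sum>\<tau>\<in>cube d. \<Sum>j<d. r \<tau> j)" .
  \<comment> \<open>Some vertex is at least as bad as the average. It may depend on the estimator,
    which the supremum over \<Theta> permits.\<close>
  have "\<exists>\<tau>\<in>cube d. 1 / 128 * real d / real n \<le> (\<Sum>j<d. r \<tau> j)"
  proof (rule ccontr)
    assume "\<not> ?thesis"
    then have "(\<Sum>\<tau>\<in>cube d. \<Sum>j<d. r \<tau> j) < (\<Sum>\<tau>\<in>cube d. 1 / 128 * real d / real n)"
      using card_cube[of d] by (intro sum_strict_mono) (auto simp: not_le)
    then show False using total by (simp add: card_cube)
  qed
  then obtain \<tau> where \<tau>: "\<tau> \<in> cube d" "1 / 128 * real d / real n \<le> (\<Sum>j<d. r \<tau> j)" by blast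
  have "ereal (1 / 128 * real d / real n) \<le> ereal (\<Sum>j<d. r \<tau> j)" using \<tau>(2) by simp
  also have "\<dots> \<le> expected_excess \<nu> d n (\<lambda>i. t * \<tau> i) ph"
    unfolding r_def by (rule expected_excess_ge[OF ph adm[OF \<tau>(1)]])
  finally show ?thesis using \<tau>(1) by blast
qed

text \<open>A flipped sign moves the inner product with \<open>x\<close> by
  \<open>2 * \<tau> j * x j\<close>. This is 2 in absolute value at every cube point, so
  \<open>log_affinity_ge\<close> applies with the same constant everywhere.\<close>

lemma eventually_affinity_ge:
  assumes "\<tau> \<in> cube d" "j < d"
  shows "\<forall>\<^sub>F t in at_right 0. 1 - V * t\<^sup>2 \<le> affinity d (\<lambda>i. t * \<tau> i) (\<lambda>i. t * flip j \<tau> i)"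
proof -
  have "\<forall>\<^sub>F t in at_right 0. \<forall>x\<in>cube d. - V * t\<^sup>2 \<le> A (t * ((dotp d \<tau> x + dotp d (flip j \<tau>) x) / 2))
      - A (t * dotp d \<tau> x) / 2 - A (t * dotp d (flip j \<tau>) x) / 2"
  proof (intro eventually_ball_finite finite_cube ballI log_affinity_ge)
    fix x assume "x \<in> cube d"
    then have "(\<tau> j * \<tau> j) * (x j * x j) = 1" using assms by (simp add: cube_sq)
    then show "(dotp d \<tau> x - dotp d (flip j \<tau>) x)\<^sup>2 = 4"
      using assms by (simp add: dotp_flip power2_eq_square mult_ac)
  qed
  then show ?thesis
  proof eventually_elim
    case (elim t)
    then show ?case
      by (intro affinity_ge) (auto simp: dotp_scale distrib_left)
  qed
qed

text \<open>The conditions under which the scaled cube serves as a set of hypotheses. Its points all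
  have squared norm \<open>real d * t\<^sup>2\<close>, so the inequality with \<open>r\<close>
  places them in the ball contained in the parameter set.\<close>

definition good_radius :: "nat \<Rightarrow> real \<Rightarrow> real \<Rightarrow> bool" where
  "good_radius d r t \<longleftrightarrow>
    (\<forall>\<tau>\<in>cube d. admissible d (\<lambda>i. t * \<tau> i)) \<and> real d * t\<^sup>2 < r\<^sup>2
    \<and> (\<forall>\<tau>\<in>cube d. \<forall>j\<in>{..<d}. 1 - V * t\<^sup>2 \<le> affinity d (\<lambda>i. t * \<tau> i) (\<lambda>i. t * flip j \<tau> i)
      \<and> V * t\<^sup>2 / 4 \<le> (coef d j (\<lambda>i. t * \<tau> i) - coef d j (\<lambda>i. t * flip j \<tau> i))\<^sup>2)"

lemma eventually_good_radius:
  assumes "0 < r"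
  shows "\<forall>\<^sub>F t in at_right 0. good_radius d r t"
  unfolding good_radius_def
proof (intro eventually_conj eventually_ball_finite finite_cube finite_lessThan ballI)
  fix \<tau> assume \<tau>: "\<tau> \<in> cube d"
  have "((\<lambda>t. \<bar>t\<bar> * real d) \<longlongrightarrow> 0) (at_right 0)"
    by (intro tendsto_eq_intros) auto
  then have "\<forall>\<^sub>F t in at_right 0. \<bar>t\<bar> * real d < \<epsilon>"
    using eps_pos by (intro order_tendstoD) auto
  then show "\<forall>\<^sub>F t in at_right 0. admissible d (\<lambda>i. t * \<tau> i)"
  proof eventually_elim
    case (elim t)
    have "\<bar>t\<bar> * \<bar>dotp d \<tau> x\<bar> \<le> \<bar>t\<bar> * real d" if "x \<in> cube d" for x
      using abs_dotp_cube_le[OF \<tau> that] by (intro mult_left_mono) auto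
    with elim show ?case
      unfolding admissible_def dotp_scale abs_mult by (meson le_less_trans)
  qed
next
  have "((\<lambda>t. real d * t\<^sup>2) \<longlongrightarrow> 0) (at_right 0)"
    by (intro tendsto_eq_intros) auto
  then show "\<forall>\<^sub>F t in at_right 0. real d * t\<^sup>2 < r\<^sup>2"
    using assms by (intro order_tendstoD) auto
next
  fix \<tau> j assume "\<tau> \<in> cube d" "j \<in> {..<d}"
  then show "\<forall>\<^sub>F t in at_right 0. 1 - V * t\<^sup>2 \<le> affinity d (\<lambda>i. t * \<tau> i) (\<lambda>i. t * flip j \<tau> i)"
    by (intro eventually_affinity_ge) auto
next
  fix \<tau> j assume "\<tau> \<in> cube d" "j \<in> {..<d}"
  then show "\<forall>\<^sub>F t in at_right 0. V * t\<^sup>2 / 4 \<le> (coef d j (\<lambda>i. t * \<tau> i) - coef d j (\<lambda>i. t * flip j \<tau> i))\<^sup>2"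
    by (intro coef_separation) auto
qed

lemma minimax_lower_bound:
  assumes r: "0 < r" "{\<theta> \<in> Rd d. (\<Sum>i<d. (\<theta> i)\<^sup>2) < r\<^sup>2} \<subseteq> \<Theta>"
  shows "\<exists>N. \<forall>n\<ge>N. ereal (1 / 128 * real d / real n)
    \<le> (INF ph \<in> estimators \<nu> d n. SUP \<theta> \<in> \<Theta>. expected_excess \<nu> d n \<theta> ph)"
proof -
  have "\<forall>\<^sub>F n in sequentially. 0 < n \<and> good_radius d r (radius n)"
    by (intro eventually_conj eventually_gt_at_top
        eventually_compose_filterlim[OF eventually_good_radius[OF r(1)] radius_at_right_0])
  then obtain N where N: "\<And>n. N \<le> n \<Longrightarrow> 0 < n \<and> good_radius d r (radius n)"
    unfolding eventually_sequentially by blast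
  show ?thesis
  proof (intro exI[of _ N] allI impI INF_greatest)
    fix n ph assume n: "N \<le> n" and ph: "ph \<in> estimators \<nu> d n"
    note C = N[OF n, unfolded good_radius_def]
    have "\<exists>\<tau>\<in>cube d. ereal (1 / 128 * real d / real n) \<le> expected_excess \<nu> d n (\<lambda>i. radius n * \<tau> i) ph"
      using C by (intro minimax_lower_bound_at[OF _ ph] radius_sq) auto
    then obtain \<tau> where \<tau>: "\<tau> \<in> cube d"
      "ereal (1 / 128 * real d / real n) \<le> expected_excess \<nu> d n (\<lambda>i. radius n * \<tau> i) ph"
      by blast
    have "(\<Sum>i<d. (radius n * \<tau> i)\<^sup>2) = real d * (radius n)\<^sup>2"
      using cube_sq[OF \<tau>(1)] by (simp add: power_mult_distrib power2_eq_square[of "\<tau> _"])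
    then have "(\<lambda>i. radius n * \<tau> i) \<in> \<Theta>"
      using C \<tau>(1) by (intro subsetD[OF r(2)]) (auto simp: cube_def Rd_def)
    then show "ereal (1 / 128 * real d / real n) \<le> (SUP \<theta>\<in>\<Theta>. expected_excess \<nu> d n \<theta> ph)"
      using \<tau>(2) SUP_upper[of _ \<Theta> "\<lambda>\<theta>. expected_excess \<nu> d n \<theta> ph"] order_trans by blast
  qed
qed

end

theorem theorem2:
  "\<exists>c>0. \<forall>(d::nat) (\<nu>::real measure) (\<Theta>::(nat \<Rightarrow> real) set).
     d \<ge> 1 \<and> sets \<nu> = sets borel
     \<and> \<not> (\<exists>y0. AE y in \<nu>. y = y0)
     \<and> (\<exists>\<epsilon>>0. {-\<epsilon><..<\<epsilon>} \<subseteq> domA \<nu>)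
     \<and> \<Theta> \<subseteq> Rd d
     \<and> (\<exists>r>0. {\<theta> \<in> Rd d. (\<Sum>i<d. (\<theta> i)\<^sup>2) < r\<^sup>2} \<subseteq> \<Theta>)
     \<and> (\<forall>\<theta>\<in>\<Theta>. \<forall>x\<in>cube d. dotp d \<theta> x \<in> domA \<nu>)
     \<longrightarrow> (\<exists>N. \<forall>n\<ge>N.
           (INF ph \<in> estimators \<nu> d n. SUP \<theta> \<in> \<Theta>. expected_excess \<nu> d n \<theta> ph)
             \<ge> ereal (c * real d / real n))"
proof (intro exI[of _ "1 / 128"] conjI allI impI; (elim conjE exE)?)
  fix d :: nat and \<nu> :: "real measure" and \<Theta> :: "(nat \<Rightarrow> real) set" and \<epsilon> r :: real
  assume *: "sets \<nu> = sets borel" "\<not> (\<exists>y0. AE y in \<nu>. y = y0)"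
    "0 < \<epsilon>" "{-\<epsilon><..<\<epsilon>} \<subseteq> domA \<nu>"
    "0 < r" "{\<theta> \<in> Rd d. (\<Sum>i<d. (\<theta> i)\<^sup>2) < r\<^sup>2} \<subseteq> \<Theta>"
  \<comment> \<open>The constant 1/128 was chosen before \<open>d\<close>, \<open>\<nu>\<close> and
    \<Theta>; only the threshold on \<open>n\<close> depends on them.\<close>
  interpret exp_family \<nu> \<epsilon> by standard (use * in auto)
  show "\<exists>N. \<forall>n\<ge>N. (INF ph \<in> estimators \<nu> d n. SUP \<theta> \<in> \<Theta>. expected_excess \<nu> d n \<theta> ph)
      \<ge> ereal (1 / 128 * real d / real n)"
    by (rule minimax_lower_bound[OF *(5,6)])
qed simp

end
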